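(* For every nonempty finite set $N$, both posets ${}^{\mathrm{Com}_2}\Pi^{+}(N)$ and $\Pi^{\mathrm{Com}_2}_{+}(N)$ are Cohen-Macaulay.
   Context: The ground field $\Bbbk$ has characteristic $0$. A finite bounded graded poset is Cohen-Macaulay (over $\Bbbk$) if for all $x<y$ the reduced homology with coefficients in $\Bbbk$ of the order complex of the open interval $(x,y)$ vanishes except possibly in its top dimension, i.e. in degree $\mathrm{rk}(y)-\mathrm{rk}(x)-2$. $\mathrm{Com}_2$ is the set-operad (whose linearization is Koszul dual to the operad $\mathrm{Lie}_2$ of two compatible Lie brackets) with $\mathrm{Com}_2(N)=\{0,1,\dots,|N|-1\}$ for $N$ a nonempty finite set, with trivial action of bijections; for a partition $\pi$ of $N$, $a\in\mathrm{Com}_2(\pi)$ and $a_B\in\mathrm{Com}_2(B)$ ($B\in\pi$), composition is $\gamma(a;(a_B)_{B\in\pi})=a+\sum_{B\in\pi}a_B$. For a set-operad $\mathcal{P}$ with composition $\gamma$ and a nonempty finite set $N$, order partitions so that coarser partitions are smaller. (i) $\Pi^{\mathcal{P}}(N)$ is the set of partitions $\pi$ of $N$ with a decoration $p_B\in\mathcal{P}(B)$ of each block $B\in\pi$; $(\sigma,(p'_A)_{A\in\sigma})\le(\pi,(p_B)_{B\in\pi})$ iff $\pi$ refines $\sigma$ and for every $A\in\sigma$ there is $r\in\mathcal{P}(\{B\in\pi:B\subset A\})$ with $p'_A=\gamma(r;(p_B)_{B\subset A})$. $\Pi^{\mathcal{P}}_+(N)$ is obtained by adjoining a new least element. (ii)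 ${}^{\mathcal{P}}\Pi(N)$ is the set of pairs $(\pi,p)$ with $\pi$ a partition of $N$ and $p\in\mathcal{P}(\pi)$ a decoration of the set of blocks; $(\sigma,p')\le(\pi,p)$ iff $\pi$ refines $\sigma$ and there are $r_A\in\mathcal{P}(\{B\in\pi:B\subset A\})$ ($A\in\sigma$) with $p=\gamma(p';(r_A)_{A\in\sigma})$. ${}^{\mathcal{P}}\Pi^+(N)$ is obtained by adjoining a new greatest element. *)

theory Defs
  imports
    "HOL-Algebra.Order"
    "HOL-Algebra.Coset"
    "HOL-Algebra.Elementary_Groups"
    "HOL-Library.Poly_Mapping"
    "HOL-Library.Disjoint_Sets"
    "HOL-Library.FuncSet"
begin

section \<open>Reduced homology of order complexes\<close>

text \<open>
  Posets are partial orders of type \<^typ>\<open>'b gorder\<close>. A \<open>d\<close>-simplex of the order complex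
  of the subposet on \<open>X\<close> is a chain of \<open>d + 1\<close> elements of \<open>X\<close>, represented by its
  increasing enumeration. The empty chain is the unique simplex of degree \<open>-1\<close>, which makes
  the complex below the augmented one.
\<close>

definition order_complex :: "'b gorder \<Rightarrow> 'b set \<Rightarrow> int \<Rightarrow> 'b list set" where
  "order_complex L X d =
     {xs. sorted_wrt (lless L) xs \<and> set xs \<subseteq> X \<and> int (length xs) = d + 1}"

definition chains :: "'b gorder \<Rightarrow> 'b set \<Rightarrow> int \<Rightarrow> ('b list \<Rightarrow>\<^sub>0 'k::field) set" where
  "chains L X d = {c. Poly_Mapping.keys c \<subseteq> order_complex L X d}"

definition boundary :: "('b list \<Rightarrow>\<^sub>0 'k::field) \<Rightarrow> ('b list \<Rightarrow>\<^sub>0 'k)" where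
  "boundary c =
     (\<Sum>xs\<in>Poly_Mapping.keys c. \<Sum>i<length xs.
        Poly_Mapping.single (take i xs @ drop (Suc i) xs) ((-1) ^ i * Poly_Mapping.lookup c xs))"

definition cycle_group ::
    "'b gorder \<Rightarrow> 'b set \<Rightarrow> int \<Rightarrow> ('b list \<Rightarrow>\<^sub>0 'k::field) monoid" where
  "cycle_group L X d =
     \<lparr>carrier = {c \<in> chains L X d. boundary c = 0}, monoid.mult = (+), one = 0\<rparr>"

definition boundary_set :: "'b gorder \<Rightarrow> 'b set \<Rightarrow> int \<Rightarrow> ('b list \<Rightarrow>\<^sub>0 'k::field) set" where
  "boundary_set L X d = boundary ` chains L X (d + 1)"

text \<open>Only the underlying additive group of the homology vector space is recorded, which is
  enough to express its vanishing. The first argument fixes the ground field.\<close>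

definition reduced_homology ::
    "'k::field itself \<Rightarrow> 'b gorder \<Rightarrow> 'b set \<Rightarrow> int \<Rightarrow> ('b list \<Rightarrow>\<^sub>0 'k) set monoid" where
  "reduced_homology K L X d = cycle_group L X d Mod boundary_set L X d"


section \<open>Cohen-Macaulay posets\<close>

definition open_interval :: "'b gorder \<Rightarrow> 'b \<Rightarrow> 'b \<Rightarrow> 'b set" where
  "open_interval L x y = {z \<in> carrier L. x \<sqsubset>\<^bsub>L\<^esub> z \<and> z \<sqsubset>\<^bsub>L\<^esub> y}"

definition finite_bounded_poset :: "'b gorder \<Rightarrow> bool" where
  "finite_bounded_poset L \<longleftrightarrow>
     partial_order L \<and> finite (carrier L) \<and>
     (\<exists>b. least L b (carrier L)) \<and> (\<exists>t. greatest L t (carrier L))"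

text \<open>A finite bounded poset is graded iff it has a rank function in the following sense; the
  rank function is then unique on the carrier.\<close>

definition rank_function :: "'b gorder \<Rightarrow> ('b \<Rightarrow> nat) \<Rightarrow> bool" where
  "rank_function L rk \<longleftrightarrow>
     (\<forall>b. least L b (carrier L) \<longrightarrow> rk b = 0) \<and>
     (\<forall>x\<in>carrier L. \<forall>y\<in>carrier L.
        x \<sqsubset>\<^bsub>L\<^esub> y \<and> open_interval L x y = {} \<longrightarrow> rk y = rk x + 1)"

definition cohen_macaulay :: "'k::field itself \<Rightarrow> 'b gorder \<Rightarrow> bool" where
  "cohen_macaulay K L \<longleftrightarrow>
     finite_bounded_poset L \<and>
     (\<exists>rk. rank_function L rk \<and>
       (\<forall>x\<in>carrier L. \<forall>y\<in>carrier L. x \<sqsubset>\<^bsub>L\<^esub> y \<longrightarrow>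
         (\<forall>d. d \<noteq> int (rk y) - int (rk x) - 2 \<longrightarrow>
            trivial_group (reduced_homology K L (open_interval L x y) d))))"


section \<open>Adjoining a least or a greatest element\<close>

definition adjoin_least :: "'b gorder \<Rightarrow> 'b option gorder" where
  "adjoin_least L =
     \<lparr>carrier = insert None (Some ` carrier L), eq = (=),
      le = (\<lambda>x y. x = None \<or> (\<exists>a b. x = Some a \<and> y = Some b \<and> a \<sqsubseteq>\<^bsub>L\<^esub> b))\<rparr>"

definition adjoin_greatest :: "'b gorder \<Rightarrow> 'b option gorder" where
  "adjoin_greatest L =
     \<lparr>carrier = insert None (Some ` carrier L), eq = (=),
      le = (\<lambda>x y. y = None \<or> (\<exists>a b. x = Some a \<and> y = Some b \<and> a \<sqsubseteq>\<^bsub>L\<^esub> b))\<rparr>"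


section \<open>The operad \<open>Com\<^sub>2\<close> and its two partition posets\<close>

definition Com2 :: "'b set \<Rightarrow> nat set" where
  "Com2 S = {..<card S}"

text \<open>The composition \<open>\<gamma>(a; (f B)\<^sub>B)\<close>, with \<open>B\<close> ranging over the blocks of a partition \<open>\<pi>\<close>.
  Bijections act trivially, so \<open>\<pi>\<close> may be replaced by any set indexing its blocks.\<close>

definition Com2_comp :: "'b set \<Rightarrow> nat \<Rightarrow> ('b \<Rightarrow> nat) \<Rightarrow> nat" where
  "Com2_comp \<pi> a f = a + (\<Sum>B\<in>\<pi>. f B)"

definition blocks_in :: "'a set set \<Rightarrow> 'a set \<Rightarrow> 'a set set" where
  "blocks_in \<pi> A = {B \<in> \<pi>. B \<subseteq> A}"

text \<open>\<open>\<Pi>\<^sup>P(N)\<close> for \<open>P = Com\<^sub>2\<close>: every block is decorated. Coarser partitions are smaller.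
  In \<^term>\<open>refines N \<pi> \<sigma>\<close>, \<open>\<pi>\<close> is the finer partition.\<close>

definition block_decorated_partitions :: "'a set \<Rightarrow> ('a set set \<times> ('a set \<Rightarrow> nat)) gorder" where
  "block_decorated_partitions N =
     \<lparr>carrier = {(\<pi>, p). partition_on N \<pi> \<and> p \<in> PiE \<pi> Com2}, eq = (=),
      le = (\<lambda>(\<sigma>, p') (\<pi>, p). refines N \<pi> \<sigma> \<and>
              (\<forall>A\<in>\<sigma>. \<exists>r\<in>Com2 (blocks_in \<pi> A). p' A = Com2_comp (blocks_in \<pi> A) r p))\<rparr>"

text \<open>The poset \<open>\<^sup>P\<Pi>(N)\<close> for \<open>P = Com\<^sub>2\<close>: the set of blocks is decorated. In the composite,
  \<open>A \<in> \<sigma>\<close> indexes the block \<^term>\<open>blocks_in \<pi> A\<close> of the partition of \<open>\<pi>\<close> induced by \<open>\<sigma>\<close>.\<close>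

definition set_decorated_partitions :: "'a set \<Rightarrow> ('a set set \<times> nat) gorder" where
  "set_decorated_partitions N =
     \<lparr>carrier = {(\<pi>, p). partition_on N \<pi> \<and> p \<in> Com2 \<pi>}, eq = (=),
      le = (\<lambda>(\<sigma>, p') (\<pi>, p). refines N \<pi> \<sigma> \<and>
              (\<exists>r. (\<forall>A\<in>\<sigma>. r A \<in> Com2 (blocks_in \<pi> A)) \<and> p = Com2_comp \<sigma> p' r))\<rparr>"

end

theory Submission
  imports Defs
begin

text \<open>Write \<open>(x, y)\<close> for an open interval of rank \<open>r\<close>. By Mayer--Vietoris, if an ideal \<open>I\<close> of
  \<open>(x, y)\<close> has no reduced homology below degree \<open>r - 2\<close>, \<open>c\<close> is a coatom outside \<open>I\<close>, and
  \<open>I \<inter> (x, c)\<close> has no reduced homology below degree \<open>r - 3\<close>, then adding the principal ideal of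
  \<open>c\<close>, which is a cone, to \<open>I\<close> creates no homology below degree \<open>r - 2\<close>. So it suffices to find
  families of ideals, generated by coatoms, that are closed under removing a suitable last
  coatom \<open>c\<close> and under intersecting the rest with the elements below \<open>c\<close>; this is a recursive atom
  ordering of the dual poset. Apart from the adjoined greatest element, a coatom
  below an element merges two blocks and carries a choice of \<open>0\<close> or \<open>1\<close> for the decoration.\<close>

section \<open>Chains in order complexes\<close>

text \<open>Both orders amount to a pair of opposite inequalities: the difference of the decorations
  is at least 0 and at most the number of blocks lost, globally in one poset and block by block in
  the other. A coatom with choice 0 tightens the bound by the number of blocks, one with choice 1
  tightens the other bound. So an element below \<open>y\<close> is below a coatom iff the two
  blocks are merged in it and one inequality is strict. Hence an ideal generated by coatoms is
  recorded by two sets \<open>E0\<close> and \<open>E1\<close>, one for each inequality. Coatoms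
  with choice 0 are removed first, which keeps \<open>E0 \<subseteq> E1\<close>. Below a removed
  coatom its own inequality is strict for free, and this turns the intersection into an ideal of the
  same kind. The sets consist of points or pairs of points of \<open>N\<close>, which, unlike
  blocks, keep their meaning in the coarser partition of the coatom. The induction must avoid ideals
  that miss the lower end \<open>x\<close> of the interval: they leave it empty, and the empty
  complex has homology in degree -1.\<close>

definition lext :: "('b \<Rightarrow> 'k::field \<Rightarrow> 'c \<Rightarrow>\<^sub>0 'k) \<Rightarrow> ('b \<Rightarrow>\<^sub>0 'k) \<Rightarrow> 'c \<Rightarrow>\<^sub>0 'k" where
  "lext f c = (\<Sum>x\<in>Poly_Mapping.keys c. f x (Poly_Mapping.lookup c x))"

lemma additive_zero:
  fixes f :: "'k::field \<Rightarrow> 'c \<Rightarrow>\<^sub>0 'k"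
  assumes "\<And>a b. f (a + b) = f a + f b"
  shows "f 0 = 0"
  using assms[of 0 0] by simp

lemma lext_add:
  assumes add: "\<And>x a b. f x (a + b) = f x a + f x b"
  shows "lext f (c + d) = lext f c + lext f d"
proof -
  let ?A = "Poly_Mapping.keys c \<union> Poly_Mapping.keys d"
  have zero: "f x 0 = 0" for x
    by (rule additive_zero) (rule add)
  have ext: "lext f e = (\<Sum>x\<in>?A. f x (Poly_Mapping.lookup e x))" if "Poly_Mapping.keys e \<subseteq> ?A" for e
    unfolding lext_def using that
    by (intro sum.mono_neutral_left) (auto simp: in_keys_iff zero)
  show ?thesis
    using keys_add[of c d] by (simp add: ext lookup_add add sum.distrib)
qed

lemma lext_single:
  assumes "f x 0 = 0"
  shows "lext f (Poly_Mapping.single x k) = f x k"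
  using assms by (simp add: lext_def)

text \<open>Reduces additive identities to single simplices. The support \<open>S\<close> is carried
  along because the sign in the boundary of a join depends on the length of the keys.\<close>

lemma poly_mapping_keys_induct [consumes 1, case_names zero single add]:
  fixes c :: "'b \<Rightarrow>\<^sub>0 'k::comm_monoid_add"
  assumes "Poly_Mapping.keys c \<subseteq> S"
    and "P 0" and "\<And>x k. x \<in> S \<Longrightarrow> P (Poly_Mapping.single x k)"
    and "\<And>a b. P a \<Longrightarrow> P b \<Longrightarrow> P (a + b)"
  shows "P c"
proof -
  have *: "c = (\<Sum>x\<in>Poly_Mapping.keys c. Poly_Mapping.single x (Poly_Mapping.lookup c x))"
    by (rule poly_mapping_eqI) (auto simp: lookup_sum lookup_single when_def in_keys_iff)
  have "P (\<Sum>x\<in>A. Poly_Mapping.single x (g x))" if "finite A" "A \<subseteq> S" for A and g :: "'b \<Rightarrow> 'k"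
    using that by (induction A) (auto intro: assms(2-))
  with * assms(1) show ?thesis
    by (metis finite_keys)
qed

section \<open>The augmented simplicial boundary\<close>

definition simplex_boundary :: "'b list \<Rightarrow> 'k::field \<Rightarrow> 'b list \<Rightarrow>\<^sub>0 'k" where
  "simplex_boundary xs k =
     (\<Sum>i<length xs. Poly_Mapping.single (take i xs @ drop (Suc i) xs) ((-1) ^ i * k))"

lemma simplex_boundary_add: "simplex_boundary xs (a + b) = simplex_boundary xs a + simplex_boundary xs b"
  by (simp add: simplex_boundary_def distrib_left single_add sum.distrib)

lemma boundary_eq_lext: "boundary = lext simplex_boundary"
  by (simp add: fun_eq_iff boundary_def lext_def simplex_boundary_def)

lemma boundary_add: "boundary (c + d) = boundary c + boundary d"
  by (simp add: boundary_eq_lext lext_add simplex_boundary_add)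

lemma boundary_zero [simp]: "boundary 0 = 0"
  by (simp add: boundary_def)

lemma boundary_uminus: "boundary (- c) = - boundary c"
  using boundary_add[of c "- c"] by (simp add: eq_neg_iff_add_eq_0 add.commute)

lemma boundary_diff: "boundary (c - d) = boundary c - boundary d"
  using boundary_add[of c "- d"] by (simp add: boundary_uminus)

lemma boundary_single: "boundary (Poly_Mapping.single xs k) = simplex_boundary xs k"
  unfolding boundary_eq_lext
  by (rule lext_single, rule additive_zero) (rule simplex_boundary_add)

section \<open>Joining a chain with a new last vertex\<close>

definition snoc_chain :: "'b \<Rightarrow> ('b list \<Rightarrow>\<^sub>0 'k::field) \<Rightarrow> 'b list \<Rightarrow>\<^sub>0 'k" where
  "snoc_chain x = lext (\<lambda>xs. Poly_Mapping.single (xs @ [x]))"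

lemma snoc_chain_add: "snoc_chain x (c + d) = snoc_chain x c + snoc_chain x d"
  unfolding snoc_chain_def by (rule lext_add) (rule single_add)

lemma snoc_chain_zero [simp]: "snoc_chain x 0 = 0"
  by (simp add: snoc_chain_def lext_def)

lemma snoc_chain_single:
  "snoc_chain x (Poly_Mapping.single xs k) = Poly_Mapping.single (xs @ [x]) k"
  unfolding snoc_chain_def by (rule lext_single) simp

lemma snoc_chain_sum: "snoc_chain x (\<Sum>i\<in>I. f i) = (\<Sum>i\<in>I. snoc_chain x (f i))"
  by (induction I rule: infinite_finite_induct) (auto simp: snoc_chain_add)

lemma snoc_chain_uminus: "snoc_chain x (- c) = - snoc_chain x c"
  using snoc_chain_add[of x c "- c"] by (simp add: eq_neg_iff_add_eq_0 add.commute)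

lemma keys_sum_subset:
  "Poly_Mapping.keys (\<Sum>i\<in>I. f i) \<subseteq> (\<Union>i\<in>I. Poly_Mapping.keys (f i))"
proof (induction I rule: infinite_finite_induct)
  case (insert i I)
  have "(\<Sum>i\<in>insert i I. f i) = f i + (\<Sum>i\<in>I. f i)"
    using insert.hyps by simp
  then show ?case
    using insert.IH keys_add[of "f i" "\<Sum>i\<in>I. f i"] by auto
qed simp_all

lemma keys_lext:
  "Poly_Mapping.keys (lext f c) \<subseteq> (\<Union>x\<in>Poly_Mapping.keys c. Poly_Mapping.keys (f x (Poly_Mapping.lookup c x)))"
  unfolding lext_def by (rule keys_sum_subset)

lemma keys_single_subset: "Poly_Mapping.keys (Poly_Mapping.single x k) \<subseteq> {x}"
  by simp

lemma keys_snoc_chain: "Poly_Mapping.keys (snoc_chain x c) \<subseteq> (\<lambda>xs. xs @ [x]) ` Poly_Mapping.keys c"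
  unfolding snoc_chain_def by (rule order_trans[OF keys_lext]) (use keys_single_subset in fast)

lemma keys_simplex_boundary:
  "Poly_Mapping.keys (simplex_boundary xs k) \<subseteq> (\<lambda>i. take i xs @ drop (Suc i) xs) ` {..<length xs}"
  unfolding simplex_boundary_def
  by (rule order_trans[OF keys_sum_subset]) (use keys_single_subset in fast)

lemma keys_boundary:
  assumes "ys \<in> Poly_Mapping.keys (boundary c)"
  obtains xs i where "xs \<in> Poly_Mapping.keys c" "i < length xs" "ys = take i xs @ drop (Suc i) xs"
proof -
  obtain xs where "xs \<in> Poly_Mapping.keys c"
    "ys \<in> Poly_Mapping.keys (simplex_boundary xs (Poly_Mapping.lookup c xs))"
    using assms keys_lext[of simplex_boundary c] unfolding boundary_eq_lext by blast
  then show thesis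
    using keys_simplex_boundary[of xs] that by fast
qed

text \<open>Appending at the end leaves the positions, hence the signs, of the earlier vertices
  unchanged; the only new face is the one that omits \<open>x\<close>.\<close>

lemma simplex_boundary_snoc:
  "simplex_boundary (xs @ [x]) k =
     snoc_chain x (simplex_boundary xs k) + Poly_Mapping.single xs ((-1) ^ length xs * k)"
  by (simp add: simplex_boundary_def snoc_chain_sum snoc_chain_single)

lemma single_sign:
  "Poly_Mapping.single xs ((-1) ^ n * (k::'k::field)) =
     (if even n then Poly_Mapping.single xs k else - Poly_Mapping.single xs k)"
  by (simp add: minus_one_power_iff single_uminus)

lemma boundary_snoc_chain:
  assumes "Poly_Mapping.keys c \<subseteq> {xs. length xs = n}"
  shows "boundary (snoc_chain x c) = snoc_chain x (boundary c) + (if even n then c else - c)"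
  using assms
proof (induction rule: poly_mapping_keys_induct)
  case (single xs k)
  then show ?case
    by (simp add: snoc_chain_single boundary_single simplex_boundary_snoc single_sign)
next
  case (add a b)
  then show ?case by (auto simp: snoc_chain_add boundary_add)
qed auto

text \<open>In the induction along the last vertex, \<open>simplex_boundary xs k\<close> appears
  twice: from the join and from omitting the last vertex. The signs are opposite because the lengths
  involved differ by one.\<close>

lemma boundary_simplex_boundary: "boundary (simplex_boundary xs k) = 0"
proof (induction xs rule: rev_induct)
  case Nil
  show ?case by (simp add: simplex_boundary_def)
next
  case (snoc x xs)
  show ?case
  proof (cases "xs = []")
    case True
    then show ?thesis
      by (simp add: simplex_boundary_def boundary_single)
  next
    case False
    have "Poly_Mapping.keys (simplex_boundary xs k) \<subseteq> {ys. length ys = length xs - 1}"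
      using keys_simplex_boundary[of xs k] by auto
    from boundary_snoc_chain[OF this, of x] snoc False show ?thesis
      by (simp add: simplex_boundary_snoc boundary_add single_sign boundary_single boundary_uminus)
  qed
qed

lemma boundary_boundary [simp]: "boundary (boundary c) = 0"
  by (rule poly_mapping_keys_induct[of c UNIV])
    (auto simp: boundary_single boundary_simplex_boundary boundary_add)

lemma boundary_chains:
  assumes "c \<in> chains L X d"
  shows "boundary c \<in> chains L X (d - 1)"
  unfolding chains_def
proof (intro CollectI subsetI)
  fix ys assume "ys \<in> Poly_Mapping.keys (boundary c)"
  then obtain xs i where xs: "xs \<in> Poly_Mapping.keys c" "i < length xs"
    and ys: "ys = take i xs @ drop (Suc i) xs"
    by (rule keys_boundary)
  have "xs \<in> order_complex L X d"
    using assms xs by (auto simp: chains_def)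
  moreover obtain us v vs where "xs = us @ v # vs" "ys = us @ vs"
    using id_take_nth_drop[OF xs(2)] ys by metis
  ultimately show "ys \<in> order_complex L X (d - 1)"
    by (auto simp: order_complex_def sorted_wrt_append)
qed

lemma chains_add: "a \<in> chains L X d \<Longrightarrow> b \<in> chains L X d \<Longrightarrow> a + b \<in> chains L X d"
  using keys_add[of a b] by (auto simp: chains_def)

lemma keys_uminus: "Poly_Mapping.keys (- (c :: 'b \<Rightarrow>\<^sub>0 'k::field)) = Poly_Mapping.keys c"
  by (auto simp: in_keys_iff)

lemma chains_uminus: "a \<in> chains L X d \<Longrightarrow> - a \<in> chains L X d"
  by (simp add: chains_def keys_uminus)

lemma chains_zero: "0 \<in> chains L X d"
  by (simp add: chains_def)

lemma chains_mono: "X \<subseteq> Y \<Longrightarrow> chains L X d \<subseteq> chains L Y d"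
  by (auto simp: chains_def order_complex_def)

lemma boundary_setI: "e \<in> chains L X (d + 1) \<Longrightarrow> boundary e = c \<Longrightarrow> c \<in> boundary_set L X d"
  by (auto simp: boundary_set_def)

lemma split_keys:
  fixes c :: "'b \<Rightarrow>\<^sub>0 'k::field"
  assumes "Poly_Mapping.keys c \<subseteq> S \<union> T"
  obtains a b where "c = a + b" "Poly_Mapping.keys a \<subseteq> S" "Poly_Mapping.keys b \<subseteq> T"
proof -
  have "\<exists>a b. c = a + b \<and> Poly_Mapping.keys a \<subseteq> S \<and> Poly_Mapping.keys b \<subseteq> T"
    using assms
  proof (induction rule: poly_mapping_keys_induct)
    case zero
    show ?case by (intro exI[of _ 0]) auto
  next
    case (single x k)
    then consider "x \<in> S" | "x \<in> T" by blast
    then show ?case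
    proof cases
      case 1
      then show ?thesis
        by (intro exI[of _ "Poly_Mapping.single x k"] exI[of _ 0]) auto
    next
      case 2
      then show ?thesis
        by (intro exI[of _ 0] exI[of _ "Poly_Mapping.single x k"]) auto
    qed
  next
    case (add c c')
    then obtain a b a' b' where "c = a + b" "c' = a' + b'"
      and keys: "Poly_Mapping.keys a \<subseteq> S" "Poly_Mapping.keys b \<subseteq> T"
        "Poly_Mapping.keys a' \<subseteq> S" "Poly_Mapping.keys b' \<subseteq> T" by blast
    then have "c + c' = (a + a') + (b + b')"
      by (simp add: algebra_simps)
    moreover have "Poly_Mapping.keys (a + a') \<subseteq> S" "Poly_Mapping.keys (b + b') \<subseteq> T"
      using keys_add[of a a'] keys_add[of b b'] keys by blast+
    ultimately show ?case by blast
  qed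
  then show thesis using that by blast
qed

section \<open>Vanishing of reduced homology below a given degree\<close>

text \<open>Degree -1 is included, so for \<open>m \<ge> 0\<close> the set \<open>X\<close> must be
  nonempty. Working with chains and not with quotient groups lets Mayer--Vietoris be carried out on
  elements.\<close>

definition acyclic_below :: "'k::field itself \<Rightarrow> 'b gorder \<Rightarrow> 'b set \<Rightarrow> int \<Rightarrow> bool" where
  "acyclic_below K L X m \<longleftrightarrow>
     (\<forall>d<m. \<forall>c::'b list \<Rightarrow>\<^sub>0 'k. c \<in> chains L X d \<longrightarrow> boundary c = 0 \<longrightarrow> c \<in> boundary_set L X d)"

lemma chains_trivial:
  assumes "order_complex L X d = {}"
  shows "chains L X d = {0}"
  using assms by (auto simp: chains_def)

lemma acyclic_below_minus_one:
  fixes L :: "'b gorder" and K :: "'k::field itself"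
  assumes "m \<le> -1"
  shows "acyclic_below K L X m"
  unfolding acyclic_below_def
proof (intro allI impI)
  fix d and c :: "'b list \<Rightarrow>\<^sub>0 'k" assume "d < m" "c \<in> chains L X d" 
  moreover have "order_complex L X d = {}" if "d < m"
    using that assms by (auto simp: order_complex_def)
  ultimately have "c = 0" using chains_trivial by blast
  then show "c \<in> boundary_set L X d"
    using chains_zero[of L X "d + 1"] by (auto simp: boundary_set_def intro!: rev_image_eqI)
qed

text \<open>The complex is a cone with apex \<open>t\<close>. A cycle is the join of some
  \<open>a\<close> with \<open>t\<close> plus a chain \<open>b\<close> avoiding \<open>t\<close>.
  Its part avoiding \<open>t\<close> has boundary \<open>a\<close> up to sign, so the cycle is, up
  to sign, the boundary of the join of \<open>b\<close> with \<open>t\<close>.\<close>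

lemma acyclic_below_cone:
  fixes L :: "'b gorder" and K :: "'k::field itself"
  assumes t: "t \<in> X" "\<And>z. z \<in> X \<Longrightarrow> z \<noteq> t \<Longrightarrow> z \<sqsubset>\<^bsub>L\<^esub> t"
    and nt: "\<And>z. z \<in> X \<Longrightarrow> \<not> t \<sqsubset>\<^bsub>L\<^esub> z"
  shows "acyclic_below K L X m"
  unfolding acyclic_below_def
proof (intro allI impI)
  fix d and c :: "'b list \<Rightarrow>\<^sub>0 'k" 
  assume c: "c \<in> chains L X d" and bc: "boundary c = 0"
  let ?Y = "X - {t}"
  have "Poly_Mapping.keys c \<subseteq> (\<lambda>xs. xs @ [t]) ` order_complex L ?Y (d - 1) \<union> order_complex L ?Y d"
  proof
    fix xs assume "xs \<in> Poly_Mapping.keys c"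
    then have xs: "xs \<in> order_complex L X d" using c by (auto simp: chains_def)
    show "xs \<in> (\<lambda>xs. xs @ [t]) ` order_complex L ?Y (d - 1) \<union> order_complex L ?Y d"
    proof (cases "t \<in> set xs")
      case True
      then obtain ys zs where xs_eq: "xs = ys @ t # zs" by (auto simp: in_set_conv_decomp)
      have "zs = []"
      proof (rule ccontr)
        assume "zs \<noteq> []"
        then have "t \<sqsubset>\<^bsub>L\<^esub> hd zs" "hd zs \<in> X"
          using xs by (auto simp: order_complex_def xs_eq sorted_wrt_append)
        then show False using nt by blast
      qed
      then have "ys \<in> order_complex L ?Y (d - 1)"
        using xs nt[OF t(1)] by (auto simp: order_complex_def xs_eq sorted_wrt_append)
      then show ?thesis using \<open>zs = []\<close> xs_eq by blast
    next
      case False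
      then show ?thesis using xs by (auto simp: order_complex_def)
    qed
  qed
  then obtain a' b where c_eq: "c = a' + b"
    and a': "Poly_Mapping.keys a' \<subseteq> (\<lambda>xs. xs @ [t]) ` order_complex L ?Y (d - 1)"
    and b: "Poly_Mapping.keys b \<subseteq> order_complex L ?Y d"
    by (rule split_keys)
  have "\<exists>a. a' = snoc_chain t a \<and> Poly_Mapping.keys a \<subseteq> order_complex L ?Y (d - 1)"
    using a'
  proof (induction rule: poly_mapping_keys_induct)
    case zero
    show ?case by (intro exI[of _ 0]) auto
  next
    case (single ys k)
    then obtain xs where "ys = xs @ [t]" "xs \<in> order_complex L ?Y (d - 1)" by blast
    then show ?case
      by (intro exI[of _ "Poly_Mapping.single xs k"]) (auto simp: snoc_chain_single)
  next
    case (add p q)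
    then obtain a b where "p = snoc_chain t a" "q = snoc_chain t b"
      and keys: "Poly_Mapping.keys a \<subseteq> order_complex L ?Y (d - 1)"
        "Poly_Mapping.keys b \<subseteq> order_complex L ?Y (d - 1)" by blast
    then have "p + q = snoc_chain t (a + b)"
      by (simp add: snoc_chain_add)
    moreover have "Poly_Mapping.keys (a + b) \<subseteq> order_complex L ?Y (d - 1)"
      using keys_add[of a b] keys by blast
    ultimately show ?case by blast
  qed
  then obtain a where a'_eq: "a' = snoc_chain t a"
    and a: "Poly_Mapping.keys a \<subseteq> order_complex L ?Y (d - 1)" by blast
  define n where "n = nat d"
  have ka: "Poly_Mapping.keys a \<subseteq> {xs. length xs = n}"
    using a by (auto simp: order_complex_def n_def)
  have kb: "Poly_Mapping.keys b \<subseteq> {xs. length xs = nat (d + 1)}"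
    using b by (auto simp: order_complex_def)
  \<comment> \<open>The first summand is supported on simplices that contain \<open>t\<close>, the
    second on simplices that avoid it, so the second vanishes by itself.\<close>
  have sum0: "snoc_chain t (boundary a) + ((if even n then a else - a) + boundary b) = 0"
    using bc boundary_snoc_chain[OF ka, of t] 
    by (simp add: c_eq a'_eq boundary_add add.assoc)
  have nk: "ys \<notin> Poly_Mapping.keys ((if even n then a else - a) + boundary b)" if "t \<in> set ys" for ys
  proof
    assume "ys \<in> Poly_Mapping.keys ((if even n then a else - a) + boundary b)"
    then consider "ys \<in> Poly_Mapping.keys a" | "ys \<in> Poly_Mapping.keys (boundary b)"
      using keys_add[of "if even n then a else - a" "boundary b"] by (auto simp: keys_uminus split: if_splits)
    then show False
    proof cases
      case 1
      then show False using a that by (auto simp: order_complex_def)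
    next
      case 2
      have "boundary b \<in> chains L ?Y (d - 1)"
        using b by (intro boundary_chains) (simp add: chains_def)
      with 2 that show False by (auto simp: chains_def order_complex_def)
    qed
  qed
  have "(if even n then a else - a) + boundary b = 0"
  proof (rule poly_mapping_eqI)
    fix ys
    show "Poly_Mapping.lookup ((if even n then a else - a) + boundary b) ys = Poly_Mapping.lookup 0 ys"
    proof (cases "t \<in> set ys")
      case True
      then show ?thesis using nk by (simp add: in_keys_iff)
    next
      case False
      then have "ys \<notin> Poly_Mapping.keys (snoc_chain t (boundary a))"
        using keys_snoc_chain[of t "boundary a"] by auto
      then show ?thesis
        using arg_cong[OF sum0, of "\<lambda>p. Poly_Mapping.lookup p ys"]
        by (simp add: lookup_add in_keys_iff)
    qed
  qed
  then have "boundary b = - (if even n then a else - a)"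
    by (metis add_eq_0_iff)
  then have bb: "boundary b = (if even n then - a else a)"
    by simp
  have "(\<lambda>xs. xs @ [t]) ` Poly_Mapping.keys b \<subseteq> order_complex L X (d + 1)"
  proof
    fix ys assume "ys \<in> (\<lambda>xs. xs @ [t]) ` Poly_Mapping.keys b"
    then obtain xs where "ys = xs @ [t]" and xs: "xs \<in> order_complex L ?Y d" using b by auto
    moreover have "z \<sqsubset>\<^bsub>L\<^esub> t" if "z \<in> set xs" for z
      using xs that t(2)[of z] by (auto simp: order_complex_def)
    ultimately show "ys \<in> order_complex L X (d + 1)"
      using t(1) by (auto simp: order_complex_def sorted_wrt_append)
  qed
  then have snoc_b: "snoc_chain t b \<in> chains L X (d + 1)"
    using keys_snoc_chain[of t b] by (auto simp: chains_def)
  show "c \<in> boundary_set L X d"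
  \<comment> \<open>For \<open>d < 0\<close> both \<open>nat d\<close> and
    \<open>nat (d + 1)\<close> are 0 and the parities no longer alternate; there
    \<open>a = 0\<close> and the cycle is \<open>b\<close> itself.\<close>
  proof (cases "d \<ge> 0")
    case True
    let ?e = "if even n then - snoc_chain t b else snoc_chain t b"
    have "nat (d + 1) = Suc n" using True by (simp add: n_def nat_add_distrib)
    then have "boundary ?e = c"
      using boundary_snoc_chain[OF kb, of t] bb
      by (auto simp: boundary_uminus c_eq a'_eq snoc_chain_uminus)
    moreover have "?e \<in> chains L X (d + 1)"
      using snoc_b by (simp add: chains_uminus)
    ultimately show ?thesis by (rule boundary_setI[rotated])
  next
    case False
    have "Poly_Mapping.keys a = {}"
      using a False by (auto simp: order_complex_def)
    then have "a = 0" by simp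
    then have "boundary (snoc_chain t b) = c"
      using boundary_snoc_chain[OF kb, of t] bb False
      by (auto simp: c_eq a'_eq)
    with snoc_b show ?thesis by (rule boundary_setI)
  qed
qed

text \<open>Mayer--Vietoris: the splitting of a cycle of the union yields a cycle of the intersection in
  one degree less, and a chain bounded by the latter corrects both summands to cycles.\<close>

lemma acyclic_below_union:
  fixes L :: "'b gorder" and K :: "'k::field itself"
  assumes U: "acyclic_below K L U m" and W: "acyclic_below K L W m"
    and UW: "acyclic_below K L (U \<inter> W) (m - 1)"
    and cover: "\<And>xs. sorted_wrt (lless L) xs \<Longrightarrow> set xs \<subseteq> U \<union> W \<Longrightarrow> set xs \<subseteq> U \<or> set xs \<subseteq> W"
  shows "acyclic_below K L (U \<union> W) m"
  unfolding acyclic_below_def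
proof (intro allI impI)
  fix d and c :: "'b list \<Rightarrow>\<^sub>0 'k"
  assume d: "d < m" and c: "c \<in> chains L (U \<union> W) d" and bc: "boundary c = 0"
  have "order_complex L (U \<union> W) d \<subseteq> order_complex L U d \<union> order_complex L W d"
    unfolding order_complex_def using cover by blast
  with c have "Poly_Mapping.keys c \<subseteq> order_complex L U d \<union> order_complex L W d"
    by (auto simp: chains_def)
  then obtain a b where c_eq: "c = a + b"
    and "Poly_Mapping.keys a \<subseteq> order_complex L U d" "Poly_Mapping.keys b \<subseteq> order_complex L W d"
    by (rule split_keys)
  then have a: "a \<in> chains L U d" and b: "b \<in> chains L W d" by (auto simp: chains_def)
  have bab: "boundary b = - boundary a"
    using bc by (simp add: c_eq boundary_add eq_neg_iff_add_eq_0 add.commute)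
  have "boundary a \<in> chains L U (d - 1)" "boundary a \<in> chains L W (d - 1)"
    using boundary_chains[OF a] chains_uminus[OF boundary_chains[OF b]] bab by auto
  then have "boundary a \<in> chains L (U \<inter> W) (d - 1)"
    by (auto simp: chains_def order_complex_def)
  then have "boundary a \<in> boundary_set L (U \<inter> W) (d - 1)"
    using UW d by (auto simp: acyclic_below_def)
  then obtain e where e: "e \<in> chains L (U \<inter> W) d" "boundary e = boundary a"
    by (auto simp: boundary_set_def)
  then have eU: "e \<in> chains L U d" and eW: "e \<in> chains L W d"
    using chains_mono[of "U \<inter> W" _ L d] by auto
  have "a - e \<in> chains L U d" "b + e \<in> chains L W d"
    using chains_add[OF a chains_uminus[OF eU]] chains_add[OF b eW] by auto
  moreover have "boundary (a - e) = 0" "boundary (b + e) = 0"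
    using e bab by (auto simp: boundary_diff boundary_add)
  ultimately have "a - e \<in> boundary_set L U d" "b + e \<in> boundary_set L W d"
    using U W d unfolding acyclic_below_def by blast+
  then obtain p q where "p \<in> chains L U (d + 1)" "q \<in> chains L W (d + 1)"
    and pq: "boundary p = a - e" "boundary q = b + e"
    by (auto simp: boundary_set_def)
  then have "p + q \<in> chains L (U \<union> W) (d + 1)"
    using chains_mono[of U "U \<union> W" L "d + 1"] chains_mono[of W "U \<union> W" L "d + 1"]
    by (intro chains_add) auto
  moreover have "boundary (p + q) = c"
    by (simp add: boundary_add pq c_eq)
  ultimately show "c \<in> boundary_set L (U \<union> W) d"
    by (rule boundary_setI)
qed

text \<open>If all cycles are boundaries, homology is the quotient of the cycle group by
  itself.\<close>

lemma trivial_reduced_homology: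
  assumes "\<And>c::'b list \<Rightarrow>\<^sub>0 'k::field. c \<in> chains L X d \<Longrightarrow> boundary c = 0 \<Longrightarrow> c \<in> boundary_set L X d"
  shows "trivial_group (reduced_homology TYPE('k) L X d)"
proof -
  let ?Z = "cycle_group L X d :: ('b list \<Rightarrow>\<^sub>0 'k) monoid"
  have inv: "\<exists>y\<in>carrier ?Z. y \<otimes>\<^bsub>?Z\<^esub> x = \<one>\<^bsub>?Z\<^esub>" if "x \<in> carrier ?Z" for x
    using that by (intro bexI[of _ "- x"]) (auto simp: cycle_group_def chains_uminus boundary_uminus)
  interpret Z: comm_group ?Z
  proof (rule comm_groupI)
    show "\<exists>y\<in>carrier ?Z. y \<otimes>\<^bsub>?Z\<^esub> x = \<one>\<^bsub>?Z\<^esub>" if "x \<in> carrier ?Z" for x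
      using that by (rule inv)
  qed (simp_all add: cycle_group_def chains_add chains_zero boundary_add ac_simps)
  have eq: "boundary_set L X d = carrier ?Z"
    using assms boundary_chains[of _ L X "d + 1"]
    by (auto simp: boundary_set_def cycle_group_def)
  have "carrier ?Z \<lhd> ?Z"
    by (simp add: Z.normal_invI Z.subgroup_self)
  then have "group (?Z Mod carrier ?Z)"
    by (rule normal.factorgroup_is_group)
  moreover have "carrier (?Z Mod carrier ?Z) = {\<one>\<^bsub>?Z Mod carrier ?Z\<^esub>}"
    by (auto simp: FactGroup_def RCOSETS_def Z.coset_join2 Z.subgroup_self)
  ultimately show ?thesis
    by (simp add: reduced_homology_def eq trivial_group_def)
qed

section \<open>Ideals built by adding one principal ideal at a time\<close>

text \<open>The last element of a chain decides: an ideal containing it contains the whole chain.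
  This provides the covering condition of Mayer--Vietoris.\<close>

lemma chain_in_ideal:
  assumes "sorted_wrt (lless L) xs" "set xs \<subseteq> U \<union> W"
    and U: "\<And>z w. w \<in> U \<Longrightarrow> z \<in> U \<union> W \<Longrightarrow> z \<sqsubset>\<^bsub>L\<^esub> w \<Longrightarrow> z \<in> U"
    and W: "\<And>z w. w \<in> W \<Longrightarrow> z \<in> U \<union> W \<Longrightarrow> z \<sqsubset>\<^bsub>L\<^esub> w \<Longrightarrow> z \<in> W"
  shows "set xs \<subseteq> U \<or> set xs \<subseteq> W"
proof (cases xs rule: rev_cases)
  case (snoc ys w)
  then have "\<forall>z\<in>set ys. z \<sqsubset>\<^bsub>L\<^esub> w" "w \<in> U \<union> W" "set ys \<subseteq> U \<union> W"
    using assms(1,2) by (auto simp: sorted_wrt_append)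
  then show ?thesis
    using U[of w] W[of w] snoc by auto
qed simp

text \<open>A state \<open>s\<close> of \<open>y\<close> describes an ideal \<open>P y s\<close> of the elements below \<open>y\<close>. The ideal arises from
  that of a smaller state \<open>s1\<close> by adding the principal ideal of a coatom \<open>c\<close>, below which the
  ideal of \<open>s1\<close> is described by a state \<open>s2\<close> of \<open>c\<close>. Nothing is required of the least element of
  the poset when \<open>c\<close> covers it.\<close>

definition splits_off ::
    "'b gorder \<Rightarrow> ('b \<Rightarrow> nat) \<Rightarrow> ('b \<Rightarrow> 's \<Rightarrow> 'b \<Rightarrow> bool) \<Rightarrow> 'b \<Rightarrow> 's \<Rightarrow> 's \<Rightarrow> 'b \<Rightarrow> 's \<Rightarrow> bool" where
  "splits_off L rk P y s s1 c s2 \<longleftrightarrow>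
     c \<in> carrier L \<and> c \<sqsubset>\<^bsub>L\<^esub> y \<and> rk y = rk c + 1 \<and> \<not> P y s1 c \<and>
     (\<forall>z\<in>carrier L. z \<sqsubset>\<^bsub>L\<^esub> y \<longrightarrow> P y s z = (P y s1 z \<or> z \<sqsubseteq>\<^bsub>L\<^esub> c)) \<and>
     (\<forall>z\<in>carrier L. z \<sqsubset>\<^bsub>L\<^esub> c \<longrightarrow> (\<exists>w\<in>carrier L. w \<sqsubset>\<^bsub>L\<^esub> z) \<or> rk z + 1 < rk c \<longrightarrow>
        P y s1 z = P c s2 z)"

text \<open>The first alternative only changes the description of the ideal. It serves coatoms whose
  decoration would be out of range and the passage from one exhausted block to the next.\<close>

definition state_step ::
    "'b gorder \<Rightarrow> ('b \<Rightarrow> nat) \<Rightarrow> ('b \<Rightarrow> 's \<Rightarrow> bool) \<Rightarrow> ('b \<Rightarrow> 's \<Rightarrow> 'b \<Rightarrow> bool) \<Rightarrow> ('s \<Rightarrow> nat) \<Rightarrow>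
      'b \<Rightarrow> 's \<Rightarrow> bool" where
  "state_step L rk valid P \<mu> y s \<longleftrightarrow>
     (\<exists>s1. valid y s1 \<and> \<mu> s1 < \<mu> s \<and>
       ((\<forall>z\<in>carrier L. z \<sqsubset>\<^bsub>L\<^esub> y \<longrightarrow> P y s z = P y s1 z) \<or>
        (\<exists>c s2. valid c s2 \<and> splits_off L rk P y s s1 c s2)))"

lemma state_stepI:
  assumes "valid y s1" "\<mu> s1 < \<mu> s" "valid c s2"
    and "c \<in> carrier L" "c \<sqsubset>\<^bsub>L\<^esub> y" "rk y = rk c + 1" "\<not> P y s1 c"
    and "\<And>z. z \<in> carrier L \<Longrightarrow> z \<sqsubset>\<^bsub>L\<^esub> y \<Longrightarrow> P y s z = (P y s1 z \<or> z \<sqsubseteq>\<^bsub>L\<^esub> c)"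
    and "\<And>z. z \<in> carrier L \<Longrightarrow> z \<sqsubset>\<^bsub>L\<^esub> c \<Longrightarrow>
      (\<exists>w\<in>carrier L. w \<sqsubset>\<^bsub>L\<^esub> z) \<or> rk z + 1 < rk c \<Longrightarrow> P y s1 z = P c s2 z"
  shows "state_step L rk valid P \<mu> y s"
  unfolding state_step_def splits_off_def using assms by blast

locale ideal_states = partial_order L for L :: "'b gorder" (structure) +
  fixes rk :: "'b \<Rightarrow> nat" and valid :: "'b \<Rightarrow> 's \<Rightarrow> bool"
    and P :: "'b \<Rightarrow> 's \<Rightarrow> 'b \<Rightarrow> bool" and \<mu> :: "'s \<Rightarrow> nat"
  assumes step: "\<And>y s. y \<in> carrier L \<Longrightarrow> valid y s \<Longrightarrow>
      (\<forall>z\<in>carrier L. z \<sqsubset> y \<longrightarrow> \<not> P y s z) \<or> state_step L rk valid P \<mu> y s"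
begin

lemma lless_le_trans:
  assumes "a \<sqsubseteq> b" "b \<sqsubset> c" "a \<in> carrier L" "b \<in> carrier L" "c \<in> carrier L"
  shows "a \<sqsubset> c"
  using assms le_antisym le_trans by (metis lless_eq)

text \<open>Unfolding the steps along \<open>\<mu>\<close> exhibits \<open>P y s\<close> as a finite
  union of principal ideals.\<close>

lemma P_downward:
  assumes "y \<in> carrier L" "valid y s" "z \<in> carrier L" "z' \<in> carrier L"
    and "z' \<sqsubseteq> z" "z \<sqsubset> y" "P y s z"
  shows "P y s z'"
  using assms(2,7)
proof (induction "\<mu> s" arbitrary: s rule: less_induct)
  case less
  have z'y: "z' \<sqsubset> y" using lless_le_trans assms by blast
  from step[OF \<open>y \<in> carrier L\<close> less.prems(1)] less.prems assms
  obtain s1 where s1: "valid y s1" "\<mu> s1 < \<mu> s"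
    and "(\<forall>z\<in>carrier L. z \<sqsubset> y \<longrightarrow> P y s z = P y s1 z) \<or>
         (\<exists>c\<in>carrier L. \<forall>z\<in>carrier L. z \<sqsubset> y \<longrightarrow> P y s z = (P y s1 z \<or> z \<sqsubseteq> c))"
    unfolding state_step_def splits_off_def by blast
  then show ?case
  proof (elim disjE bexE)
    assume "\<forall>z\<in>carrier L. z \<sqsubset> y \<longrightarrow> P y s z = P y s1 z"
    then show ?thesis using less.hyps[OF s1(2,1)] less.prems assms z'y by blast
  next
    fix c assume c: "c \<in> carrier L"
      and eq: "\<forall>z\<in>carrier L. z \<sqsubset> y \<longrightarrow> P y s z = (P y s1 z \<or> z \<sqsubseteq> c)"
    show ?thesis
    proof (cases "P y s1 z")
      case True
      then show ?thesis using less.hyps[OF s1(2,1)] eq assms z'y by blast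
    next
      case False
      then have "z \<sqsubseteq> c" using eq less.prems assms by blast
      then have "z' \<sqsubseteq> c" using assms c le_trans by blast
      then show ?thesis using eq assms z'y by blast
    qed
  qed
qed

text \<open>The outer induction on rank handles the intersection with the principal ideal of
  \<open>c\<close>, which lives below \<open>c\<close>; the inner one on \<open>\<mu>\<close>
  handles the remaining coatoms. The hypothesis \<open>P y s x\<close> puts a generating coatom
  weakly above \<open>x\<close>; otherwise the set would be empty and have homology in degree
  -1.\<close>

lemma acyclic_below_ideal:
  fixes K :: "'k::field itself"
  assumes x: "x \<in> carrier L" and "y \<in> carrier L" "x \<sqsubset> y" "valid y s" "P y s x"
  shows "acyclic_below K L {z \<in> open_interval L x y. P y s z} (int (rk y) - int (rk x) - 2)"
  using assms(2-)
proof (induction "rk y" arbitrary: y s rule: less_induct)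
  case less
  note y = \<open>y \<in> carrier L\<close> and xy = \<open>x \<sqsubset> y\<close>
  from less.prems(3,4) show ?case
  proof (induction "\<mu> s" arbitrary: s rule: less_induct)
    case (less s)
    note IH_y = \<open>\<And>c s. rk c < rk y \<Longrightarrow> c \<in> carrier L \<Longrightarrow> x \<sqsubset> c \<Longrightarrow> valid c s \<Longrightarrow> P c s x \<Longrightarrow>
       acyclic_below K L {z \<in> open_interval L x c. P c s z} (int (rk c) - int (rk x) - 2)\<close>
    note IH_s = less.hyps
    define D where "D s = {z \<in> open_interval L x y. P y s z}" for s
    let ?m = "int (rk y) - int (rk x) - 2"
    from step[OF y less.prems(1)] less.prems(2) xy x
    obtain s1 where s1: "valid y s1" "\<mu> s1 < \<mu> s"
      and s1_cases: "(\<forall>z\<in>carrier L. z \<sqsubset> y \<longrightarrow> P y s z = P y s1 z) \<or>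
         (\<exists>c s2. valid c s2 \<and> splits_off L rk P y s s1 c s2)"
      unfolding state_step_def by blast
    have IH1: "acyclic_below K L (D s1) ?m" if "P y s1 x"
      using IH_s[OF s1(2,1) that] by (simp add: D_def)
    have same: "acyclic_below K L (D s) ?m"
      if "\<And>z. z \<in> carrier L \<Longrightarrow> x \<sqsubseteq> z \<Longrightarrow> z \<sqsubset> y \<Longrightarrow> P y s z = P y s1 z"
    proof -
      have "P y s1 x" using that[of x] less.prems(2) x xy by blast
      moreover have "D s = D s1"
        using that by (auto simp: D_def open_interval_def lless_eq)
      ultimately show ?thesis using IH1 by simp
    qed
    from s1_cases have "acyclic_below K L (D s) ?m"
    proof (elim disjE exE conjE)
      assume "\<forall>z\<in>carrier L. z \<sqsubset> y \<longrightarrow> P y s z = P y s1 z"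
      then show ?thesis by (intro same) blast
    next
      fix c s2
      assume s2: "valid c s2" and "splits_off L rk P y s s1 c s2"
      then have c: "c \<in> carrier L" "c \<sqsubset> y" and rk: "rk y = rk c + 1"
        and nc: "\<not> P y s1 c"
        and eq: "\<And>z. z \<in> carrier L \<Longrightarrow> z \<sqsubset> y \<Longrightarrow> P y s z = (P y s1 z \<or> z \<sqsubseteq> c)"
        and eq2: "\<And>z. z \<in> carrier L \<Longrightarrow> z \<sqsubset> c \<Longrightarrow> (\<exists>w\<in>carrier L. w \<sqsubset> z) \<or> rk z + 1 < rk c \<Longrightarrow>
          P y s1 z = P c s2 z"
        unfolding splits_off_def by blast+
      let ?W = "{z \<in> open_interval L x y. z \<sqsubseteq> c}"
      have D_eq: "D s = D s1 \<union> ?W"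
        using eq by (auto simp: D_def open_interval_def)
      show ?thesis
      proof (cases "x \<sqsubseteq> c")
        \<comment> \<open>A coatom that is not above \<open>x\<close> contributes nothing to the
          interval.\<close>
        case False
        then have "\<not> z \<sqsubseteq> c" if "z \<in> carrier L" "x \<sqsubseteq> z" for z
          using that c x le_trans by blast
        then show ?thesis using eq by (intro same) blast
      next
        case xc: True
        show ?thesis
        proof (cases "x = c")
          case True
          then show ?thesis by (intro acyclic_below_minus_one) (simp add: rk)
        next
          case False
          with xc have xc': "x \<sqsubset> c" by (simp add: lless_eq)
          have cone: "acyclic_below K L ?W m" for m
          proof (rule acyclic_below_cone)
            show "c \<in> ?W" using c xc' by (auto simp: open_interval_def)
            show "z \<sqsubset> c" if "z \<in> ?W" "z \<noteq> c" for z using that by (auto simp: lless_eq)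
            show "\<not> c \<sqsubset> z" if "z \<in> ?W" for z
              using that c le_antisym by (auto simp: open_interval_def lless_eq)
          qed
          show ?thesis
          \<comment> \<open>If the old ideal misses \<open>x\<close>, it misses the whole interval
            by downward closure, and only the cone is left.\<close>
          proof (cases "P y s1 x")
            case False
            then have "D s1 = {}"
              using P_downward[OF y s1(1) _ x]
              by (auto simp: D_def open_interval_def lless_eq)
            with cone show ?thesis by (simp add: D_eq)
          next
            case True
            \<comment> \<open>Since \<open>\<not> P y s1 c\<close>, the apex \<open>c\<close> is not
              in the intersection, which therefore lies in the open interval below
              \<open>c\<close>.\<close>
            have W_eq: "D s1 \<inter> ?W = {z \<in> open_interval L x c. P c s2 z}" (is "?l = ?r")
            proof (intro Set.set_eqI iffI)
              fix z assume z: "z \<in> ?l"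
              then have "z \<sqsubset> c" using nc by (auto simp: D_def lless_eq)
              with z eq2[of z] x show "z \<in> ?r" by (auto simp: D_def open_interval_def)
            next
              fix z assume z: "z \<in> ?r"
              then have "z \<sqsubset> y" using lless_trans c y by (auto simp: open_interval_def)
              with z eq2[of z] x show "z \<in> ?l" by (auto simp: D_def open_interval_def lless_eq)
            qed
            have "acyclic_below K L (D s1 \<inter> ?W) (?m - 1)"
            \<comment> \<open>If the ranks differ by at most one, the bound \<open>?m - 1\<close> is
              at most -1 and there is nothing to show. This is what permits the exemption of the
              least element in \<open>splits_off\<close>.\<close>
            proof (cases "rk x + 1 < rk c")
              case rk_c: True
              then have "P c s2 x" using eq2[OF x xc'] \<open>P y s1 x\<close> by blast
              from IH_y[OF _ c(1) xc' s2 this] show ?thesis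
                by (simp add: W_eq rk algebra_simps)
            next
              case False
              then show ?thesis by (intro acyclic_below_minus_one) (simp add: rk)
            qed
            moreover have "set xs \<subseteq> D s1 \<or> set xs \<subseteq> ?W"
              if "sorted_wrt (lless L) xs" "set xs \<subseteq> D s1 \<union> ?W" for xs
            proof (rule chain_in_ideal[OF that])
              fix z w assume "w \<in> D s1" "z \<in> D s1 \<union> ?W" "z \<sqsubset> w"
              then show "z \<in> D s1"
                using P_downward[OF y s1(1), of w z] by (auto simp: D_def open_interval_def lless_eq)
            next
              fix z w assume "w \<in> ?W" "z \<in> D s1 \<union> ?W" "z \<sqsubset> w"
              then show "z \<in> ?W"
                using c le_trans[of z w c] by (auto simp: D_def open_interval_def lless_eq)
            qed
            ultimately show ?thesis
              unfolding D_eq by (intro acyclic_below_union IH1 cone True)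
          qed
        qed
      qed
    qed
    then show ?case by (simp add: D_def)
  qed
qed

lemma acyclic_below_open_interval:
  assumes "x \<in> carrier L" "y \<in> carrier L" "x \<sqsubset> y" "valid y s"
    and "\<And>z. z \<in> carrier L \<Longrightarrow> z \<sqsubset> y \<Longrightarrow> P y s z"
  shows "acyclic_below K L (open_interval L x y) (int (rk y) - int (rk x) - 2)"
proof -
  have "{z \<in> open_interval L x y. P y s z} = open_interval L x y"
    using assms(5) by (auto simp: open_interval_def)
  with acyclic_below_ideal[of x y s K] assms show ?thesis by simp
qed

end

text \<open>Above the top degree there are no chains at all, as ranks increase strictly along a
  chain and stay strictly between \<open>rk x\<close> and \<open>rk y\<close>. The element
  \<open>c\<close> of the cover condition must be \<open>x\<close> when the interval is empty, so
  \<open>rk\<close> is the rank function.\<close>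

lemma cohen_macaulayI:
  assumes "partial_order L" and fin: "finite (carrier L)"
    and b: "least L b (carrier L)" and t: "greatest L t (carrier L)" and rk_b: "rk b = (0::nat)"
    and mono: "\<And>x y. x \<in> carrier L \<Longrightarrow> y \<in> carrier L \<Longrightarrow> x \<sqsubset>\<^bsub>L\<^esub> y \<Longrightarrow> rk x < rk y"
    and cover: "\<And>x y. x \<in> carrier L \<Longrightarrow> y \<in> carrier L \<Longrightarrow> x \<sqsubset>\<^bsub>L\<^esub> y \<Longrightarrow>
      \<exists>c\<in>carrier L. x \<sqsubseteq>\<^bsub>L\<^esub> c \<and> c \<sqsubset>\<^bsub>L\<^esub> y \<and> rk y = rk c + 1"
    and acyclic: "\<And>x y. x \<in> carrier L \<Longrightarrow> y \<in> carrier L \<Longrightarrow> x \<sqsubset>\<^bsub>L\<^esub> y \<Longrightarrow>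
      acyclic_below TYPE('k::field) L (open_interval L x y) (int (rk y) - int (rk x) - 2)"
  shows "cohen_macaulay TYPE('k) L"
proof -
  interpret partial_order L by fact
  have "rank_function L rk"
    unfolding rank_function_def
  proof (intro conjI allI ballI impI)
    fix b' assume "least L b' (carrier L)"
    then have "b' = b" using b least_unique by blast
    then show "rk b' = 0" by (simp add: rk_b)
  next
    fix x y assume xy: "x \<in> carrier L" "y \<in> carrier L" and "x \<sqsubset>\<^bsub>L\<^esub> y \<and> open_interval L x y = {}"
    then obtain c where "c \<in> carrier L" "x \<sqsubseteq>\<^bsub>L\<^esub> c" "c \<sqsubset>\<^bsub>L\<^esub> y" "rk y = rk c + 1"
      and empty: "open_interval L x y = {}"
      using cover by blast
    moreover have "x = c"
      using calculation by (auto simp: open_interval_def lless_eq)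
    ultimately show "rk y = rk x + 1" by simp
  qed
  moreover have "trivial_group (reduced_homology TYPE('k) L (open_interval L x y) d)"
    if xy: "x \<in> carrier L" "y \<in> carrier L" "x \<sqsubset>\<^bsub>L\<^esub> y" and d: "d \<noteq> int (rk y) - int (rk x) - 2" for x y d
  proof (rule trivial_reduced_homology)
    fix c :: "'a list \<Rightarrow>\<^sub>0 'k"
    assume c: "c \<in> chains L (open_interval L x y) d" "boundary c = 0"
    consider "d < int (rk y) - int (rk x) - 2" | "d > int (rk y) - int (rk x) - 2"
      using d by linarith
    then show "c \<in> boundary_set L (open_interval L x y) d"
    proof cases
      case 1
      then show ?thesis using acyclic[OF xy] c by (auto simp: acyclic_below_def)
    next
      case 2
      have "int (length xs) \<le> int (rk y) - int (rk x) - 1"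
        if "sorted_wrt (lless L) xs" and sub: "set xs \<subseteq> open_interval L x y" for xs
      proof -
        have xs: "z \<in> carrier L" "x \<sqsubset>\<^bsub>L\<^esub> z" "z \<sqsubset>\<^bsub>L\<^esub> y" if "z \<in> set xs" for z
          using that sub by (auto simp: open_interval_def)
        have "sorted_wrt (<) (map rk xs)"
          using that(1) by (rule sorted_wrt_map_mono) (blast intro: mono xs)
        then have "distinct (map rk xs)"
          by (simp add: strict_sorted_iff)
        then have "length xs = card (rk ` set xs)"
          by (metis distinct_card length_map set_map)
        also have "\<dots> \<le> card {rk x<..<rk y}"
          by (rule card_mono) (auto intro!: mono xy xs)
        finally show ?thesis using mono[OF xy] by simp
      qed
      then have "order_complex L (open_interval L x y) d = {}"
        using 2 by (force simp: order_complex_def)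
      then have "c = 0" using c chains_trivial by blast
      then show ?thesis by (intro boundary_setI[of 0]) (simp_all add: chains_zero)
    qed
  qed
  ultimately show ?thesis
    unfolding cohen_macaulay_def finite_bounded_poset_def
    using assms(1) fin b t by blast
qed

section \<open>Adjoining an extremal element\<close>

lemma adjoin_greatest_simps:
  "carrier (adjoin_greatest L) = insert None (Some ` carrier L)"
  "x \<sqsubseteq>\<^bsub>adjoin_greatest L\<^esub> None"
  "\<not> None \<sqsubseteq>\<^bsub>adjoin_greatest L\<^esub> Some b"
  "Some a \<sqsubseteq>\<^bsub>adjoin_greatest L\<^esub> Some b \<longleftrightarrow> a \<sqsubseteq>\<^bsub>L\<^esub> b"
  "x \<sqsubset>\<^bsub>adjoin_greatest L\<^esub> y \<longleftrightarrow> x \<sqsubseteq>\<^bsub>adjoin_greatest L\<^esub> y \<and> x \<noteq> y"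
  by (auto simp: adjoin_greatest_def lless_def)

lemma adjoin_least_simps:
  "carrier (adjoin_least L) = insert None (Some ` carrier L)"
  "None \<sqsubseteq>\<^bsub>adjoin_least L\<^esub> x"
  "\<not> Some a \<sqsubseteq>\<^bsub>adjoin_least L\<^esub> None"
  "Some a \<sqsubseteq>\<^bsub>adjoin_least L\<^esub> Some b \<longleftrightarrow> a \<sqsubseteq>\<^bsub>L\<^esub> b"
  "x \<sqsubset>\<^bsub>adjoin_least L\<^esub> y \<longleftrightarrow> x \<sqsubseteq>\<^bsub>adjoin_least L\<^esub> y \<and> x \<noteq> y"
  by (auto simp: adjoin_least_def lless_def)

lemma partial_order_eqI:
  assumes "eq L = (=)"
    and "\<And>x. x \<in> carrier L \<Longrightarrow> x \<sqsubseteq>\<^bsub>L\<^esub> x"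
    and "\<And>x y. x \<in> carrier L \<Longrightarrow> y \<in> carrier L \<Longrightarrow> x \<sqsubseteq>\<^bsub>L\<^esub> y \<Longrightarrow> y \<sqsubseteq>\<^bsub>L\<^esub> x \<Longrightarrow> x = y"
    and "\<And>x y z. x \<in> carrier L \<Longrightarrow> y \<in> carrier L \<Longrightarrow> z \<in> carrier L \<Longrightarrow>
      x \<sqsubseteq>\<^bsub>L\<^esub> y \<Longrightarrow> y \<sqsubseteq>\<^bsub>L\<^esub> z \<Longrightarrow> x \<sqsubseteq>\<^bsub>L\<^esub> z"
  shows "partial_order L"
  by unfold_locales (simp_all add: assms(1,2), (blast intro: assms(3,4))+)

lemma partial_order_adjoin_greatest:
  assumes "partial_order L"
  shows "partial_order (adjoin_greatest L)"
proof -
  interpret partial_order L by fact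
  show ?thesis
  proof (rule partial_order_eqI)
    show "x = y" if "x \<in> carrier (adjoin_greatest L)" "y \<in> carrier (adjoin_greatest L)"
      "x \<sqsubseteq>\<^bsub>adjoin_greatest L\<^esub> y" "y \<sqsubseteq>\<^bsub>adjoin_greatest L\<^esub> x" for x y
      using that le_antisym[of "the x" "the y"] by (cases x; cases y) (auto simp: adjoin_greatest_simps)
    show "x \<sqsubseteq>\<^bsub>adjoin_greatest L\<^esub> z"
      if "x \<in> carrier (adjoin_greatest L)" "y \<in> carrier (adjoin_greatest L)"
        "z \<in> carrier (adjoin_greatest L)"
        "x \<sqsubseteq>\<^bsub>adjoin_greatest L\<^esub> y" "y \<sqsubseteq>\<^bsub>adjoin_greatest L\<^esub> z" for x y z
      using that le_trans[of "the x" "the y" "the z"] by (cases x; cases y; cases z) (auto simp: adjoin_greatest_simps)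
  qed (auto simp: adjoin_greatest_def)
qed

lemma partial_order_adjoin_least:
  assumes "partial_order L"
  shows "partial_order (adjoin_least L)"
proof -
  interpret partial_order L by fact
  show ?thesis
  proof (rule partial_order_eqI)
    show "x = y" if "x \<in> carrier (adjoin_least L)" "y \<in> carrier (adjoin_least L)"
      "x \<sqsubseteq>\<^bsub>adjoin_least L\<^esub> y" "y \<sqsubseteq>\<^bsub>adjoin_least L\<^esub> x" for x y
      using that le_antisym[of "the x" "the y"] by (cases x; cases y) (auto simp: adjoin_least_simps)
    show "x \<sqsubseteq>\<^bsub>adjoin_least L\<^esub> z"
      if "x \<in> carrier (adjoin_least L)" "y \<in> carrier (adjoin_least L)"
        "z \<in> carrier (adjoin_least L)"
        "x \<sqsubseteq>\<^bsub>adjoin_least L\<^esub> y" "y \<sqsubseteq>\<^bsub>adjoin_least L\<^esub> z" for x y z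
      using that le_trans[of "the x" "the y" "the z"] by (cases x; cases y; cases z) (auto simp: adjoin_least_simps)
  qed (auto simp: adjoin_least_def)
qed

section \<open>Partitions and merging two blocks\<close>

lemma partition_on_same_block:
  assumes "partition_on N \<pi>" "B \<in> \<pi>" "B' \<in> \<pi>" "x \<in> B" "x \<in> B'"
  shows "B = B'"
  using assms by (auto simp: partition_on_def disjoint_def)

lemma refines_block_subset:
  assumes "refines N \<pi> \<tau>" "B \<in> \<pi>" "C \<in> \<tau>" "x \<in> B" "x \<in> C"
  shows "B \<subseteq> C"
proof -
  obtain C' where "C' \<in> \<tau>" "B \<subseteq> C'" using assms by (auto simp: refines_def)
  moreover have "C' = C"
    using partition_on_same_block[of N \<tau> C' C x] assms calculation by (auto simp: refines_def)
  ultimately show ?thesis by simp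
qed

lemma partition_on_block:
  assumes "partition_on N \<pi>" "x \<in> N"
  obtains B where "B \<in> \<pi>" "x \<in> B"
  using assms by (auto simp: partition_on_def)

lemma partition_on_elem:
  assumes "partition_on N \<pi>" "B \<in> \<pi>"
  obtains x where "x \<in> B"
  using assms by (metis partition_onD3 ex_in_conv)

lemma finite_blocks_in: "finite \<pi> \<Longrightarrow> finite (blocks_in \<pi> A)"
  by (simp add: blocks_in_def)

text \<open>A block of the finer partition is nonempty, so it lies in only one block of the coarser
  one and nothing is counted twice. The set \<open>X\<close> allows for sums over all of
  \<open>\<tau>\<close> as well as over the blocks inside a block of a third partition.\<close>

lemma sum_blocks_in:
  assumes "finite N" "refines N \<pi> \<tau>" "X \<subseteq> \<tau>" "Y \<subseteq> \<pi>"
    and Y: "\<And>B. B \<in> Y \<longleftrightarrow> B \<in> \<pi> \<and> (\<exists>C\<in>X. B \<subseteq> C)"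
  shows "(\<Sum>C\<in>X. \<Sum>B\<in>blocks_in \<pi> C. f B) = (\<Sum>B\<in>Y. f B)"
proof -
  have part: "partition_on N \<pi>" "partition_on N \<tau>" using assms by (auto simp: refines_def)
  have fin: "finite \<pi>" "finite X"
    using finite_elements[OF \<open>finite N\<close>] part assms finite_subset by blast+
  have "(\<Sum>C\<in>X. \<Sum>B\<in>blocks_in \<pi> C. f B) = (\<Sum>B\<in>(\<Union>C\<in>X. blocks_in \<pi> C). f B)"
  proof (rule sum.UNION_disjoint[symmetric])
    show "\<forall>C\<in>X. \<forall>C'\<in>X. C \<noteq> C' \<longrightarrow> blocks_in \<pi> C \<inter> blocks_in \<pi> C' = {}"
    proof (intro ballI impI, rule ccontr)
      fix C C' assume C: "C \<in> X" "C' \<in> X" "C \<noteq> C'" "blocks_in \<pi> C \<inter> blocks_in \<pi> C' \<noteq> {}"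
      then obtain B where "B \<in> \<pi>" "B \<subseteq> C" "B \<subseteq> C'" by (auto simp: blocks_in_def)
      moreover obtain x where "x \<in> B"
        using part(1) \<open>B \<in> \<pi>\<close> by (rule partition_on_elem)
      ultimately show False
        using partition_on_same_block[OF part(2), of C C' x] C \<open>X \<subseteq> \<tau>\<close> by blast
    qed
  qed (use fin in \<open>auto intro: finite_blocks_in\<close>)
  also have "(\<Union>C\<in>X. blocks_in \<pi> C) = Y"
    unfolding blocks_in_def using Y by blast
  finally show ?thesis .
qed

lemma sum_blocks_in_all:
  assumes "finite N" "refines N \<pi> \<tau>"
  shows "(\<Sum>C\<in>\<tau>. \<Sum>B\<in>blocks_in \<pi> C. f B) = (\<Sum>B\<in>\<pi>. f B)"
  using assms by (intro sum_blocks_in) (auto simp: refines_def)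

lemma sum_blocks_in_nested:
  assumes "finite N" "refines N \<pi> \<tau>" "refines N \<tau> \<sigma>" "D \<in> \<sigma>"
  shows "(\<Sum>C\<in>blocks_in \<tau> D. \<Sum>B\<in>blocks_in \<pi> C. f B) = (\<Sum>B\<in>blocks_in \<pi> D. f B)"
proof (rule sum_blocks_in[OF assms(1,2)])
  fix B
  show "B \<in> blocks_in \<pi> D \<longleftrightarrow> B \<in> \<pi> \<and> (\<exists>C\<in>blocks_in \<tau> D. B \<subseteq> C)"
  proof
    assume B: "B \<in> blocks_in \<pi> D"
    then obtain C where C: "C \<in> \<tau>" "B \<subseteq> C" using assms(2) by (auto simp: refines_def blocks_in_def)
    have "B \<in> \<pi>" "partition_on N \<pi>" using B assms(2) by (auto simp: blocks_in_def refines_def)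
    then obtain x where "x \<in> B" using partition_on_elem by blast
    then have "C \<subseteq> D"
      using refines_block_subset[OF assms(3) C(1) assms(4), of x] B C by (auto simp: blocks_in_def)
    with B C show "B \<in> \<pi> \<and> (\<exists>C\<in>blocks_in \<tau> D. B \<subseteq> C)" by (auto simp: blocks_in_def)
  qed (auto simp: blocks_in_def)
qed (auto simp: blocks_in_def)

lemma card_sum_one: "card A = (\<Sum>x\<in>A. 1)"
  by simp

lemmas card_blocks_in_all = sum_blocks_in_all[where f = "\<lambda>_. 1::nat", folded card_sum_one]
lemmas card_blocks_in_nested = sum_blocks_in_nested[where f = "\<lambda>_. 1::nat", folded card_sum_one]

lemma Union_blocks_in:
  assumes "refines N \<pi> \<tau>" "C \<in> \<tau>"
  shows "\<Union>(blocks_in \<pi> C) = C"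
  using refines_obtains_subset[OF assms] by (simp add: partition_on_def blocks_in_def)

lemma blocks_in_nonempty:
  assumes "refines N \<pi> \<tau>" "C \<in> \<tau>"
  shows "blocks_in \<pi> C \<noteq> {}"
  using Union_blocks_in[OF assms] assms partition_onD3[of N \<tau>] by (auto simp: refines_def)

lemma card_blocks_in_pos:
  assumes "finite N" "refines N \<pi> \<tau>" "C \<in> \<tau>"
  shows "0 < card (blocks_in \<pi> C)"
  using blocks_in_nonempty[OF assms(2,3)] finite_elements[OF assms(1), of \<pi>] assms(2)
  by (simp add: card_gt_0_iff finite_blocks_in refines_def)

lemma blocks_in_block:
  assumes "partition_on N \<pi>" "B \<in> \<pi>"
  shows "blocks_in \<pi> B = {B}"
proof -
  have "B' = B" if "B' \<in> \<pi>" "B' \<subseteq> B" for B'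
  proof -
    obtain x where "x \<in> B'" using partition_on_elem[OF assms(1) \<open>B' \<in> \<pi>\<close>] by blast
    then show ?thesis using partition_on_same_block[OF assms(1), of B' B x] that assms by blast
  qed
  then show ?thesis using assms by (auto simp: blocks_in_def)
qed

lemma refines_card_le:
  assumes "finite N" "refines N \<pi> \<tau>"
  shows "card \<tau> \<le> card \<pi>"
proof -
  have "card \<tau> = (\<Sum>C\<in>\<tau>. 1)" by simp
  also have "\<dots> \<le> (\<Sum>C\<in>\<tau>. card (blocks_in \<pi> C))"
    by (rule sum_mono) (use card_blocks_in_pos[OF assms] in \<open>simp add: Suc_le_eq\<close>)
  also have "\<dots> = card \<pi>" by (rule card_blocks_in_all[OF assms])
  finally show ?thesis .
qed

lemma refines_eqI:
  assumes "refines N \<pi> \<tau>" and "\<And>C. C \<in> \<tau> \<Longrightarrow> C \<in> \<pi>"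
  shows "\<tau> = \<pi>"
proof -
  have "B \<in> \<tau>" if B: "B \<in> \<pi>" for B
  proof -
    obtain C where "C \<in> \<tau>" "B \<subseteq> C" using assms(1) B by (auto simp: refines_def)
    moreover have "partition_on N \<pi>" using assms(1) by (simp add: refines_def)
    moreover obtain x where "x \<in> B" using partition_on_elem[OF calculation(3) B] by blast
    ultimately show ?thesis
      using partition_on_same_block[of N \<pi> B C x] assms B by (auto simp: refines_def)
  qed
  with assms(2) show ?thesis by blast
qed

lemma card_blocks_in_gt_one:
  assumes "finite N" "refines N \<pi> \<tau>" "C \<in> \<tau>" "C \<notin> \<pi>"
  shows "1 < card (blocks_in \<pi> C)"
proof -
  have "card (blocks_in \<pi> C) \<noteq> 1"
  proof
    assume "card (blocks_in \<pi> C) = 1"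
    then obtain B where "blocks_in \<pi> C = {B}" by (auto simp: card_1_singleton_iff)
    moreover have "C = B" using calculation Union_blocks_in[OF assms(2,3)] by simp
    ultimately show False using assms(4) by (auto simp: blocks_in_def)
  qed
  then show ?thesis using card_blocks_in_pos[OF assms(1-3)] by linarith
qed

lemma refines_card_less:
  assumes "finite N" "refines N \<pi> \<tau>" "\<tau> \<noteq> \<pi>"
  shows "card \<tau> < card \<pi>"
proof -
  have fin: "finite \<tau>" using finite_elements[OF assms(1)] assms(2) by (auto simp: refines_def)
  obtain C where C: "C \<in> \<tau>" "C \<notin> \<pi>" using refines_eqI[OF assms(2)] assms(3) by blast
  have "card \<tau> = (\<Sum>C\<in>\<tau>. 1)" by simp
  also have "\<dots> < (\<Sum>C\<in>\<tau>. card (blocks_in \<pi> C))"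
  proof (rule sum_strict_mono_ex1)
    show "\<forall>C\<in>\<tau>. 1 \<le> card (blocks_in \<pi> C)"
      using card_blocks_in_pos[OF assms(1,2)] by (simp add: Suc_le_eq)
    show "\<exists>C\<in>\<tau>. 1 < card (blocks_in \<pi> C)" using C card_blocks_in_gt_one[OF assms(1,2)] by blast
  qed (rule fin)
  also have "\<dots> = card \<pi>" by (rule card_blocks_in_all[OF assms(1,2)])
  finally show ?thesis .
qed

section \<open>The finest and the coarsest partition\<close>

definition singletons :: "'a set \<Rightarrow> 'a set set" where
  "singletons N = (\<lambda>x. {x}) ` N"

lemma partition_on_singletons': "partition_on N (singletons N)"
  unfolding singletons_def by (rule partition_on_singletons)

lemma singletons_refines: "partition_on N \<tau> \<Longrightarrow> refines N (singletons N) \<tau>"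
  using partition_on_singletons'[of N] partition_on_block[of N \<tau>]
  by (force simp: refines_def singletons_def)

lemma card_singletons: "card (singletons N) = card N"
  by (auto simp: singletons_def intro!: card_image inj_onI)

lemma card_partition_pos:
  assumes "finite N" "N \<noteq> {}" "partition_on N \<pi>"
  shows "0 < card \<pi>"
  using assms finite_elements[of N \<pi>] by (auto simp: card_gt_0_iff partition_on_def)

lemma card_partition_le:
  assumes "finite N" "partition_on N \<pi>"
  shows "card \<pi> \<le> card N"
  using refines_card_le[OF assms(1) singletons_refines[OF assms(2)]] by (simp add: card_singletons)

lemma refines_single_block:
  assumes "partition_on N \<pi>" "N \<noteq> {}"
  shows "refines N \<pi> {N}"
  using assms partition_on_space[OF assms(2)] by (auto simp: refines_def partition_on_def)

section \<open>Merging two blocks, the covering relation of the partition lattice\<close>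

definition merge :: "'a set set \<Rightarrow> 'a set \<Rightarrow> 'a set \<Rightarrow> 'a set set" where
  "merge \<pi> A B = insert (A \<union> B) (\<pi> - {A, B})"

locale merge_blocks =
  fixes N :: "'a set" and \<pi> A B
  assumes N: "finite N" and part: "partition_on N \<pi>"
    and A: "A \<in> \<pi>" and B: "B \<in> \<pi>" and AB: "A \<noteq> B"
begin

lemma finite_blocks: "finite \<pi>"
  using finite_elements[OF N part] .

lemma nonempty: "A \<noteq> {}" "B \<noteq> {}"
  using A B partition_onD3[OF part] by auto

lemma disjoint: "C \<in> \<pi> \<Longrightarrow> D \<in> \<pi> \<Longrightarrow> C \<noteq> D \<Longrightarrow> C \<inter> D = {}"
  using part by (auto simp: partition_on_def disjoint_def)

lemma union_notin: "A \<union> B \<notin> \<pi>"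
  using disjoint[of "A \<union> B" A] disjoint[of "A \<union> B" B] A B AB nonempty by auto

lemma partition_merge: "partition_on N (merge \<pi> A B)"
proof (rule partition_onI)
  show "\<Union>(merge \<pi> A B) = N"
    using A B part by (auto simp: merge_def partition_on_def)
  show "{} \<notin> merge \<pi> A B"
    using nonempty partition_onD3[OF part] by (auto simp: merge_def)
  have union: "(A \<union> B) \<inter> D = {}" if "D \<in> \<pi>" "D \<noteq> A" "D \<noteq> B" for D
    using disjoint[OF A that(1)] disjoint[OF B that(1)] that by blast
  show "disjnt C D" if CD: "C \<in> merge \<pi> A B" "D \<in> merge \<pi> A B" "C \<noteq> D" for C D
  proof -
    consider "C = A \<union> B" "D \<in> \<pi> - {A, B}" | "D = A \<union> B" "C \<in> \<pi> - {A, B}" | "C \<in> \<pi>" "D \<in> \<pi>"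
      using CD unfolding merge_def by blast
    then show ?thesis
    proof cases
      case 1
      then show ?thesis using union[of D] by (simp add: disjnt_def)
    next
      case 2
      then show ?thesis using union[of C] by (simp add: disjnt_def Int_commute)
    next
      case 3
      then show ?thesis using disjoint \<open>C \<noteq> D\<close> by (simp add: disjnt_def)
    qed
  qed
qed

lemma card_merge: "card \<pi> = Suc (card (merge \<pi> A B))"
proof -
  have "card (merge \<pi> A B) = Suc (card (\<pi> - {A, B}))"
    using union_notin finite_blocks by (simp add: merge_def)
  moreover have "card (\<pi> - {A, B}) = card \<pi> - 2"
    using A B AB finite_blocks by (simp add: card_Diff_subset)
  moreover have "card {A, B} \<le> card \<pi>"
    using A B finite_blocks by (intro card_mono) auto
  ultimately show ?thesis using AB by simp
qed

lemma refines_merge: "refines N \<pi> (merge \<pi> A B)"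
  using part partition_merge by (auto simp: refines_def merge_def)

lemma merge_refines_iff:
  "refines N (merge \<pi> A B) \<tau> \<longleftrightarrow> refines N \<pi> \<tau> \<and> (\<exists>C\<in>\<tau>. A \<subseteq> C \<and> B \<subseteq> C)"
proof
  assume r: "refines N (merge \<pi> A B) \<tau>"
  then have "\<exists>C\<in>\<tau>. A \<union> B \<subseteq> C" by (auto simp: refines_def merge_def)
  moreover have "refines N \<pi> \<tau>" using refines_trans[OF refines_merge r] .
  ultimately show "refines N \<pi> \<tau> \<and> (\<exists>C\<in>\<tau>. A \<subseteq> C \<and> B \<subseteq> C)" by simp
next
  assume "refines N \<pi> \<tau> \<and> (\<exists>C\<in>\<tau>. A \<subseteq> C \<and> B \<subseteq> C)"
  then show "refines N (merge \<pi> A B) \<tau>"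
    using partition_merge by (auto simp: refines_def merge_def)
qed

lemma blocks_in_merge_super:
  assumes "A \<subseteq> C" "B \<subseteq> C"
  shows "blocks_in (merge \<pi> A B) C = insert (A \<union> B) (blocks_in \<pi> C - {A, B})"
  using assms by (auto simp: blocks_in_def merge_def)

lemma blocks_in_merge_other:
  assumes "refines N (merge \<pi> A B) \<tau>" "C \<in> \<tau>" "\<not> A \<subseteq> C"
  shows "blocks_in (merge \<pi> A B) C = blocks_in \<pi> C"
proof -
  have "\<not> B \<subseteq> C"
  proof
    assume "B \<subseteq> C"
    then have "A \<union> B \<subseteq> C"
      using refines_block_subset[OF assms(1) _ assms(2), of "A \<union> B"] nonempty
      by (auto simp: merge_def)
    then show False using assms(3) by simp
  qed
  then show ?thesis using assms(3) by (auto simp: blocks_in_def merge_def)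
qed

text \<open>Stated with additions on both sides to avoid truncated subtraction; used for counting
  blocks and for summing decorations.\<close>

lemma sum_blocks_in_merge:
  assumes "A \<subseteq> C" "B \<subseteq> C"
  shows "(\<Sum>D\<in>blocks_in (merge \<pi> A B) C. f D) + f A + f B =
    (\<Sum>D\<in>blocks_in \<pi> C. f D) + (f (A \<union> B) :: nat)"
proof -
  have fin: "finite (blocks_in \<pi> C)" using finite_blocks by (rule finite_blocks_in)
  have AB_in: "A \<in> blocks_in \<pi> C" "B \<in> blocks_in \<pi> C" using assms A B by (auto simp: blocks_in_def)
  have "(\<Sum>D\<in>blocks_in \<pi> C. f D) = f A + (f B + (\<Sum>D\<in>blocks_in \<pi> C - {A, B}. f D))"
    using sum.remove[OF fin AB_in(1), of f] sum.remove[of "blocks_in \<pi> C - {A}" B f] fin AB_in AB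
    by (simp add: Diff_insert2[symmetric] insert_commute)
  moreover have "A \<union> B \<notin> blocks_in \<pi> C" using union_notin by (simp add: blocks_in_def)
  ultimately show ?thesis
    using fin by (simp add: blocks_in_merge_super[OF assms])
qed

lemma card_blocks_in_merge:
  assumes "A \<subseteq> C" "B \<subseteq> C"
  shows "card (blocks_in \<pi> C) = Suc (card (blocks_in (merge \<pi> A B) C))"
  using sum_blocks_in_merge[OF assms, of "\<lambda>_. 1"] by simp

end

text \<open>A block of \<open>\<tau>\<close> that is not a block of \<open>\<pi>\<close> contains
  two blocks of \<open>\<pi>\<close>. Thus every proper coarsening is below a merge, which gives
  coatoms in all proofs of gradedness.\<close>

lemma coarser_merge:
  assumes "finite N" "refines N \<pi> \<tau>" "\<tau> \<noteq> \<pi>"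
  obtains A B C where "merge_blocks N \<pi> A B" "C \<in> \<tau>" "A \<subseteq> C" "B \<subseteq> C"
proof -
  have part: "partition_on N \<pi>" using assms by (auto simp: refines_def)
  obtain C where C: "C \<in> \<tau>" "C \<notin> \<pi>" using refines_eqI[OF assms(2)] assms(3) by blast
  obtain A where A: "A \<in> blocks_in \<pi> C" using blocks_in_nonempty[OF assms(2) C(1)] by blast
  have "A \<noteq> C" "A \<subseteq> C" "A \<in> \<pi>" using A C by (auto simp: blocks_in_def)
  then obtain B where "B \<in> blocks_in \<pi> C" "B \<noteq> A"
    using Union_blocks_in[OF assms(2) C(1)] by blast
  then show thesis
    using that[of A B C] assms part A C by (auto simp: merge_blocks_def blocks_in_def)
qed

section \<open>Decorations of the set of blocks\<close>

text \<open>Greedy filling: each summand takes as much of the remainder as it may hold.\<close>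

lemma bounded_summands:
  fixes c :: "'b \<Rightarrow> nat"
  assumes "finite S" "e \<le> (\<Sum>A\<in>S. c A)"
  shows "\<exists>r. (\<forall>A\<in>S. r A \<le> c A) \<and> (\<Sum>A\<in>S. r A) = e"
  using assms
proof (induction arbitrary: e)
  case (insert A S)
  define m where "m = min e (c A)"
  have "e - m \<le> (\<Sum>A\<in>S. c A)" using insert by (auto simp: m_def)
  then obtain r where r: "\<forall>A\<in>S. r A \<le> c A" "(\<Sum>A\<in>S. r A) = e - m" using insert.IH by blast
  have "(\<Sum>B\<in>S. (r(A := m)) B) = (\<Sum>B\<in>S. r B)"
    using insert.hyps by (intro sum.cong) auto
  then show ?case
    using r insert.hyps by (intro exI[of _ "r(A := m)"]) (auto simp: m_def)
qed simp

text \<open>The values \<open>r A\<close> vary independently from 0 to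
  \<open>card (blocks_in \<pi> A) - 1\<close>, and these maxima add up to
  \<open>card \<pi> - card \<sigma>\<close>. So their sum takes every value in between, and the
  existential over \<open>r\<close> disappears.\<close>

lemma set_decorated_le_iff:
  assumes "finite N"
  shows "(\<sigma>, q) \<sqsubseteq>\<^bsub>set_decorated_partitions N\<^esub> (\<pi>, p) \<longleftrightarrow>
    refines N \<pi> \<sigma> \<and> q \<le> p \<and> p + card \<sigma> \<le> q + card \<pi>"
proof (cases "refines N \<pi> \<sigma>")
  case True
  then have fin: "finite \<sigma>" using finite_elements[OF assms] by (auto simp: refines_def)
  have pos: "0 < card (blocks_in \<pi> A)" if "A \<in> \<sigma>" for A
    using card_blocks_in_pos[OF assms True that] .
  have "(\<Sum>A\<in>\<sigma>. card (blocks_in \<pi> A) - 1) + card \<sigma> = (\<Sum>A\<in>\<sigma>. card (blocks_in \<pi> A) - 1 + 1)"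
    by (simp only: sum.distrib) simp
  also have "\<dots> = card \<pi>"
    unfolding card_blocks_in_all[OF assms True, symmetric]
    by (rule sum.cong) (use pos in \<open>auto simp: Suc_le_eq\<close>)
  finally have sum: "(\<Sum>A\<in>\<sigma>. card (blocks_in \<pi> A) - 1) + card \<sigma> = card \<pi>" .
  have "(\<exists>r. (\<forall>A\<in>\<sigma>. r A \<in> Com2 (blocks_in \<pi> A)) \<and> p = Com2_comp \<sigma> q r) \<longleftrightarrow>
    q \<le> p \<and> p + card \<sigma> \<le> q + card \<pi>" (is "?l \<longleftrightarrow> ?r")
  proof
    assume ?l
    then obtain r where r: "\<forall>A\<in>\<sigma>. r A < card (blocks_in \<pi> A)" "p = q + (\<Sum>A\<in>\<sigma>. r A)"
      by (auto simp: Com2_def Com2_comp_def)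
    have "(\<Sum>A\<in>\<sigma>. r A) \<le> (\<Sum>A\<in>\<sigma>. card (blocks_in \<pi> A) - 1)"
      using r(1) by (intro sum_mono) fastforce
    with r(2) sum show ?r by simp
  next
    assume ?r
    then have "p - q \<le> (\<Sum>A\<in>\<sigma>. card (blocks_in \<pi> A) - 1)" using sum by linarith
    from bounded_summands[OF fin this] obtain r
      where r: "\<forall>A\<in>\<sigma>. r A \<le> card (blocks_in \<pi> A) - 1" "(\<Sum>A\<in>\<sigma>. r A) = p - q" by blast
    have "r A < card (blocks_in \<pi> A)" if "A \<in> \<sigma>" for A
      using r(1) pos[OF that] that by fastforce
    then show ?l
      using r(2) \<open>?r\<close> by (intro exI[of _ r]) (auto simp: Com2_def Com2_comp_def)
  qed
  then show ?thesis by (simp add: set_decorated_partitions_def)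
qed (simp add: set_decorated_partitions_def)

lemma set_decorated_carrier:
  "(\<pi>, p) \<in> carrier (set_decorated_partitions N) \<longleftrightarrow> partition_on N \<pi> \<and> p < card \<pi>"
  by (simp add: set_decorated_partitions_def Com2_def)

lemma partial_order_set_decorated:
  assumes "finite N"
  shows "partial_order (set_decorated_partitions N)"
proof (rule partial_order_eqI)
  let ?set_poset = "set_decorated_partitions N"
  show "eq ?set_poset = (=)" by (simp add: set_decorated_partitions_def)
  show "x \<sqsubseteq>\<^bsub>?set_poset\<^esub> x" if "x \<in> carrier ?set_poset" for x
    using that refines_refl by (cases x) (auto simp: set_decorated_le_iff[OF assms] set_decorated_carrier)
  show "x = y" if "x \<sqsubseteq>\<^bsub>?set_poset\<^esub> y" "y \<sqsubseteq>\<^bsub>?set_poset\<^esub> x" for x y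
    using that refines_asym by (cases x; cases y) (auto simp: set_decorated_le_iff[OF assms])
  show "x \<sqsubseteq>\<^bsub>?set_poset\<^esub> z" if "x \<sqsubseteq>\<^bsub>?set_poset\<^esub> y" "y \<sqsubseteq>\<^bsub>?set_poset\<^esub> z" for x y z
    using that refines_trans[of N "fst z" "fst y" "fst x"]
    by (cases x; cases y; cases z) (auto simp: set_decorated_le_iff[OF assms])
qed

section \<open>Pairs of points as labels of merges\<close>

definition joined :: "'a set set \<Rightarrow> 'a \<times> 'a \<Rightarrow> bool" where
  "joined \<tau> e \<longleftrightarrow> (\<exists>C\<in>\<tau>. fst e \<in> C \<and> snd e \<in> C)"

lemma joined_refines: "refines N \<pi> \<tau> \<Longrightarrow> joined \<pi> e \<Longrightarrow> joined \<tau> e"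
  unfolding joined_def refines_def by (meson subsetD)

lemma joined_merge_blocks:
  assumes part: "partition_on N \<pi>" and N: "finite N" and e: "e \<in> N \<times> N" "\<not> joined \<pi> e"
  obtains A B where "merge_blocks N \<pi> A B" "joined (merge \<pi> A B) e"
proof -
  have "fst e \<in> N" "snd e \<in> N" using e(1) by auto
  obtain A where A: "A \<in> \<pi>" "fst e \<in> A" by (rule partition_on_block[OF part \<open>fst e \<in> N\<close>])
  obtain B where B: "B \<in> \<pi>" "snd e \<in> B" by (rule partition_on_block[OF part \<open>snd e \<in> N\<close>])
  have "A \<noteq> B" using A B e by (auto simp: joined_def)
  then show thesis
    using that[of A B] A B part N by (auto simp: merge_blocks_def joined_def merge_def)
qed

text \<open>Translates a label into the principal ideal of its merge. Several pairs may label the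
  same merge, so a step drops all pairs that the merge joins, not only \<open>e\<close>.\<close>

lemma joined_merge_iff:
  assumes "merge_blocks N \<pi> A B" "refines N \<pi> \<tau>" "\<not> joined \<pi> e" "joined (merge \<pi> A B) e"
  shows "joined \<tau> e \<longleftrightarrow> refines N (merge \<pi> A B) \<tau>"
proof
  interpret merge_blocks N \<pi> A B by fact
  assume "joined \<tau> e"
  then obtain C where C: "C \<in> \<tau>" "fst e \<in> C" "snd e \<in> C" by (auto simp: joined_def)
  have "fst e \<in> A \<and> snd e \<in> B \<or> fst e \<in> B \<and> snd e \<in> A"
    using assms(3,4) A B by (auto simp: joined_def merge_def)
  then have "A \<subseteq> C" "B \<subseteq> C"
    using refines_block_subset[OF assms(2) A C(1)] refines_block_subset[OF assms(2) B C(1)] C by blast+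
  then show "refines N (merge \<pi> A B) \<tau>"
    using C assms(2) by (auto simp: merge_refines_iff)
qed (rule joined_refines[OF _ assms(4)])

text \<open>Ensures that the set of all pairs not joined by \<open>\<pi>\<close> accounts for every
  proper coarsening.\<close>

lemma exists_newly_joined:
  assumes "finite N" "refines N \<pi> \<tau>" "\<tau> \<noteq> \<pi>"
  obtains e where "e \<in> N \<times> N" "\<not> joined \<pi> e" "joined \<tau> e"
proof -
  obtain A B C where m: "merge_blocks N \<pi> A B" and C: "C \<in> \<tau>" "A \<subseteq> C" "B \<subseteq> C"
    using coarser_merge[OF assms] .
  interpret merge_blocks N \<pi> A B by fact
  obtain a b where ab: "a \<in> A" "b \<in> B" using nonempty by blast
  have "\<not> joined \<pi> (a, b)"
    using partition_on_same_block[OF part A _ ab(1)] partition_on_same_block[OF part B _ ab(2)] AB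
    by (auto simp: joined_def)
  moreover have "joined \<tau> (a, b)" using ab C by (auto simp: joined_def)
  moreover have "(a, b) \<in> N \<times> N" using ab A B part by (auto simp: partition_on_def)
  ultimately show thesis using that by blast
qed

text \<open>Below \<open>(\<pi>, p)\<close> the coatoms merge the blocks of a pair of points and
  lower the decoration by \<open>0\<close> or \<open>1\<close>. A state consists of the sets \<open>E\<^sub>0 \<subseteq> E\<^sub>1\<close> of pairs of either
  kind. Below the adjoined greatest element, the state \<open>k\<close> stands for the coatoms with a decoration
  less than \<open>k\<close>.\<close>

fun set_valid :: "'a set \<Rightarrow> ('a set set \<times> nat) option \<Rightarrow> nat \<times> ('a \<times> 'a) set \<times> ('a \<times> 'a) set \<Rightarrow> bool" where
  "set_valid N None (k, E0, E1) \<longleftrightarrow> k \<le> card N \<and> E0 = {} \<and> E1 = {}"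
| "set_valid N (Some (\<pi>, p)) (k, E0, E1) \<longleftrightarrow> E0 \<subseteq> E1 \<and> E1 \<subseteq> N \<times> N \<and> (\<forall>e\<in>E1. \<not> joined \<pi> e)"

text \<open>The inequalities \<open>t < p\<close> and
  \<open>p + card \<tau> < t + card \<pi>\<close> are the strict forms of those in the order; they
  leave room for a merge with choice 1 and with choice 0, respectively. Below the top,
  \<open>(\<tau>, t)\<close> lies under the singletons decorated with \<open>t\<close>, so
  \<open>t < k\<close> is the ideal of the first \<open>k\<close> coatoms.\<close>

fun set_ideal :: "('a set set \<times> nat) option \<Rightarrow> nat \<times> ('a \<times> 'a) set \<times> ('a \<times> 'a) set \<Rightarrow>
    ('a set set \<times> nat) option \<Rightarrow> bool" where
  "set_ideal None (k, E0, E1) (Some (\<tau>, t)) \<longleftrightarrow> t < k"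
| "set_ideal (Some (\<pi>, p)) (k, E0, E1) (Some (\<tau>, t)) \<longleftrightarrow>
     (t < p \<and> (\<exists>e\<in>E1. joined \<tau> e)) \<or> (p + card \<tau> < t + card \<pi> \<and> (\<exists>e\<in>E0. joined \<tau> e))"
| "set_ideal y (k, E0, E1) None \<longleftrightarrow> False"

fun set_measure :: "nat \<times> ('a \<times> 'a) set \<times> ('a \<times> 'a) set \<Rightarrow> nat" where
  "set_measure (k, E0, E1) = k + card E0 + card E1"

fun set_rank :: "'a set \<Rightarrow> ('a set set \<times> nat) option \<Rightarrow> nat" where
  "set_rank N None = card N"
| "set_rank N (Some (\<pi>, p)) = card \<pi> - 1"

section \<open>Removing coatoms when the set of blocks is decorated\<close>

context
  fixes N :: "'a set"
  assumes N: "finite N" "N \<noteq> {}"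
begin

abbreviation "set_poset \<equiv> adjoin_greatest (set_decorated_partitions N)"

lemma set_carrier: "Some (\<pi>, p) \<in> carrier set_poset \<longleftrightarrow> partition_on N \<pi> \<and> p < card \<pi>" "None \<in> carrier set_poset"
  by (auto simp: adjoin_greatest_simps set_decorated_carrier)

lemma set_le: "Some (\<sigma>, q) \<sqsubseteq>\<^bsub>set_poset\<^esub> Some (\<pi>, p) \<longleftrightarrow>
    refines N \<pi> \<sigma> \<and> q \<le> p \<and> p + card \<sigma> \<le> q + card \<pi>"
  by (simp add: adjoin_greatest_simps set_decorated_le_iff[OF N(1)])

lemmas set_less = adjoin_greatest_simps(5)

lemmas card_pos = card_partition_pos[OF N]

lemma set_less_card:
  assumes "Some (\<tau>, t) \<sqsubset>\<^bsub>set_poset\<^esub> Some (\<pi>, p)"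
  shows "\<tau> \<noteq> \<pi>" "card \<tau> < card \<pi>"
proof -
  show "\<tau> \<noteq> \<pi>" using assms by (auto simp: set_less set_le)
  then show "card \<tau> < card \<pi>"
    using assms refines_card_less[OF N(1)] by (auto simp: set_less set_le)
qed

text \<open>Below \<open>c\<close> the inequality of choice 0 is strict relative to
  \<open>y\<close>, and the pair \<open>e\<close>, which stays in \<open>E1\<close>, is joined. The
  old ideal there means \<open>t < p\<close> or some pair of \<open>E0'\<close> joined. In the state
  of \<open>c\<close> the last component therefore contains all pairs; for \<open>t = p\<close> the
  inequality of choice 0 relative to \<open>c\<close> is strict because blocks are lost.\<close>

lemma set_step_zero:
  fixes \<pi> p k E0 E1 A B
  defines "\<pi>' \<equiv> merge \<pi> A B" and "y \<equiv> Some (\<pi>, p)"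
  assumes p: "p < card \<pi>" and E: "E0 \<subseteq> E1" "E1 \<subseteq> N \<times> N" "\<forall>e\<in>E1. \<not> joined \<pi> e"
    and e: "e \<in> E0" and m: "merge_blocks N \<pi> A B" "joined \<pi>' e"
  defines "E0' \<equiv> {e\<in>E0. \<not> joined \<pi>' e}"
  shows "state_step set_poset (set_rank N) (set_valid N) set_ideal set_measure y (k, E0, E1)"
proof -
  interpret merge_blocks N \<pi> A B by fact
  have "finite E1" using finite_subset[OF E(2)] N by simp
  then have fin: "finite E0" using finite_subset[OF E(1)] by simp
  have "card E0' < card E0" using e m fin by (intro psubset_card_mono) (auto simp: E0'_def)
  then have meas: "set_measure (k, E0', E1) < set_measure (k, E0, E1)" by simp
  have val: "set_valid N y (k, E0', E1)" using E by (auto simp: y_def E0'_def)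
  have joined_iff: "(\<exists>f\<in>E0. joined \<tau> f) \<longleftrightarrow> (\<exists>f\<in>E0'. joined \<tau> f) \<or> refines N \<pi>' \<tau>"
    if "refines N \<pi> \<tau>" for \<tau>
    using joined_merge_iff[OF m(1) that, folded \<pi>'_def] E e m(2) unfolding E0'_def by blast
  have ideal: "set_ideal y (k, E0, E1) (Some (\<tau>, t)) \<longleftrightarrow> set_ideal y (k, E0', E1) (Some (\<tau>, t)) \<or>
      p + card \<tau> < t + card \<pi> \<and> refines N \<pi>' \<tau>" if "refines N \<pi> \<tau>" for \<tau> t
    using joined_iff[OF that] by (auto simp: y_def)
  have card: "card \<pi> = Suc (card \<pi>')" using card_merge by (simp add: \<pi>'_def)
  have part': "partition_on N \<pi>'" using partition_merge by (simp add: \<pi>'_def)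
  show ?thesis
  proof (cases "p < card \<pi>'")
    \<comment> \<open>Here \<open>p = card \<pi>'\<close> is not a decoration of
      \<open>\<pi>'\<close>. Strictness for choice 0 would mean \<open>card \<tau> \<le> t\<close>,
      so the dropped pairs generated nothing.\<close>
    case False
    have "set_ideal y (k, E0, E1) z = set_ideal y (k, E0', E1) z"
      if "z \<in> carrier set_poset" "z \<sqsubset>\<^bsub>set_poset\<^esub> y" for z
    proof (cases z)
      case (Some u)
      obtain \<tau> t where u: "u = (\<tau>, t)" by (cases u)
      have "t < card \<tau>" "refines N \<pi> \<tau>" using that by (auto simp: Some u set_carrier set_less set_le y_def)
      then show ?thesis using ideal False card by (auto simp: Some u)
    qed (simp add: y_def)
    with meas val show ?thesis unfolding state_step_def by blast
  next
    case True
    define c where "c = Some (\<pi>', p)"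
    define s2 where "s2 = (k, E0', {e\<in>N \<times> N. \<not> joined \<pi>' e})"
    have cL: "c \<in> carrier set_poset" using True part' by (simp add: c_def set_carrier)
    have cy: "c \<sqsubset>\<^bsub>set_poset\<^esub> y"
      using refines_merge card by (auto simp: c_def y_def set_less set_le \<pi>'_def)
    have rk: "set_rank N y = set_rank N c + 1"
      using card card_pos[OF part'] by (simp add: c_def y_def)
    have val2: "set_valid N c s2" using E by (auto simp: c_def s2_def E0'_def)
    have notin: "\<not> set_ideal y (k, E0', E1) c" by (auto simp: y_def c_def E0'_def)
    have eq1: "set_ideal y (k, E0, E1) z = (set_ideal y (k, E0', E1) z \<or> z \<sqsubseteq>\<^bsub>set_poset\<^esub> c)"
      if "z \<in> carrier set_poset" "z \<sqsubset>\<^bsub>set_poset\<^esub> y" for z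
    proof (cases z)
      case (Some u)
      obtain \<tau> t where u: "u = (\<tau>, t)" by (cases u)
      have r: "refines N \<pi> \<tau>" "t \<le> p" using that by (auto simp: Some u set_less set_le y_def)
      show ?thesis unfolding Some u ideal[OF r(1)] using r card by (auto simp: c_def set_le)
    qed (use that in \<open>simp add: y_def set_less adjoin_greatest_simps\<close>)
    have eq2: "set_ideal y (k, E0', E1) z = set_ideal c s2 z" if "z \<sqsubset>\<^bsub>set_poset\<^esub> c" for z
    proof (cases z)
      case (Some u)
      obtain \<tau> t where u: "u = (\<tau>, t)" by (cases u)
      have z: "Some (\<tau>, t) \<sqsubset>\<^bsub>set_poset\<^esub> Some (\<pi>', p)" using that by (simp only: Some u c_def)
      then have le: "Some (\<tau>, t) \<sqsubseteq>\<^bsub>set_poset\<^esub> Some (\<pi>', p)" by (simp only: set_less)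
      have r: "refines N \<pi>' \<tau>" "t \<le> p" "p + card \<tau> \<le> t + card \<pi>'" "card \<tau> < card \<pi>'" "\<tau> \<noteq> \<pi>'"
        using le set_less_card[OF z] by (simp_all add: set_le)
      have j1: "\<exists>f\<in>E1. joined \<tau> f" using joined_refines[OF r(1) m(2)] e E by blast
      have j2: "\<exists>f\<in>{e\<in>N \<times> N. \<not> joined \<pi>' e}. joined \<tau> f"
        using exists_newly_joined[OF N(1) r(1,5)] by blast
      show ?thesis
        using j1 j2 r card by (auto simp: Some u y_def c_def s2_def)
    qed (use that in \<open>simp add: c_def set_less adjoin_greatest_simps\<close>)
    show ?thesis
      by (rule state_stepI, rule val, rule meas, rule val2) (use cL cy rk notin eq1 eq2 in blast)+
  qed
qed

text \<open>Once \<open>E0\<close> is exhausted, \<open>t < p\<close> holds automatically below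
  \<open>c\<close>, and the old ideal there depends on \<open>E1'\<close> alone. An element properly
  below \<open>c\<close> has one of its two inequalities strict, so the state of \<open>c\<close>
  carries \<open>E1'\<close> in both places.\<close>

lemma set_step_one:
  fixes \<pi> p k E1 A B
  defines "\<pi>' \<equiv> merge \<pi> A B" and "y \<equiv> Some (\<pi>, p)"
  assumes p: "p < card \<pi>" and E: "E1 \<subseteq> N \<times> N" "\<forall>e\<in>E1. \<not> joined \<pi> e"
    and e: "e \<in> E1" and m: "merge_blocks N \<pi> A B" "joined \<pi>' e"
  defines "E1' \<equiv> {e\<in>E1. \<not> joined \<pi>' e}"
  shows "state_step set_poset (set_rank N) (set_valid N) set_ideal set_measure y (k, {}, E1)"
proof -
  interpret merge_blocks N \<pi> A B by fact
  have fin: "finite E1" using finite_subset[OF E(1)] N by simp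
  have "card E1' < card E1" using e m fin by (intro psubset_card_mono) (auto simp: E1'_def)
  then have meas: "set_measure (k, {}, E1') < set_measure (k, {}, E1)" by simp
  have val: "set_valid N y (k, {}, E1')" using E by (auto simp: y_def E1'_def)
  have joined_iff: "(\<exists>f\<in>E1. joined \<tau> f) \<longleftrightarrow> (\<exists>f\<in>E1'. joined \<tau> f) \<or> refines N \<pi>' \<tau>"
    if "refines N \<pi> \<tau>" for \<tau>
    using joined_merge_iff[OF m(1) that, folded \<pi>'_def] E e m(2) unfolding E1'_def by blast
  have ideal: "set_ideal y (k, {}, E1) (Some (\<tau>, t)) \<longleftrightarrow> set_ideal y (k, {}, E1') (Some (\<tau>, t)) \<or>
      t < p \<and> refines N \<pi>' \<tau>" if "refines N \<pi> \<tau>" for \<tau> t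
    using joined_iff[OF that] by (auto simp: y_def)
  have card: "card \<pi> = Suc (card \<pi>')" using card_merge by (simp add: \<pi>'_def)
  have part': "partition_on N \<pi>'" using partition_merge by (simp add: \<pi>'_def)
  show ?thesis
  proof (cases "p = 0")
    \<comment> \<open>No decoration is less than 0, so merges with choice 1 do not exist.\<close>
    case True
    have "set_ideal y (k, {}, E1) z = set_ideal y (k, {}, E1') z" for z
      by (cases z) (auto simp: y_def True)
    with meas val show ?thesis unfolding state_step_def by blast
  next
    case False
    define c where "c = Some (\<pi>', p - 1)"
    define s2 where "s2 = (k, E1', E1')"
    have cL: "c \<in> carrier set_poset" using False p card part' by (simp add: c_def set_carrier)
    have cy: "c \<sqsubset>\<^bsub>set_poset\<^esub> y"
      using refines_merge card by (auto simp: c_def y_def set_less set_le \<pi>'_def)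
    have rk: "set_rank N y = set_rank N c + 1"
      using card card_pos[OF part'] by (simp add: c_def y_def)
    have val2: "set_valid N c s2" using E by (auto simp: c_def s2_def E1'_def)
    have notin: "\<not> set_ideal y (k, {}, E1') c" by (auto simp: y_def c_def E1'_def)
    have eq1: "set_ideal y (k, {}, E1) z = (set_ideal y (k, {}, E1') z \<or> z \<sqsubseteq>\<^bsub>set_poset\<^esub> c)"
      if "z \<in> carrier set_poset" "z \<sqsubset>\<^bsub>set_poset\<^esub> y" for z
    proof (cases z)
      case (Some u)
      obtain \<tau> t where u: "u = (\<tau>, t)" by (cases u)
      have r: "refines N \<pi> \<tau>" "t \<le> p" "p + card \<tau> \<le> t + card \<pi>"
        using that by (auto simp: Some u set_less set_le y_def)
      show ?thesis unfolding Some u ideal[OF r(1)] using r card False by (auto simp: c_def set_le)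
    qed (use that in \<open>simp add: y_def set_less adjoin_greatest_simps\<close>)
    have eq2: "set_ideal y (k, {}, E1') z = set_ideal c s2 z" if "z \<sqsubset>\<^bsub>set_poset\<^esub> c" for z
    proof (cases z)
      case (Some u)
      obtain \<tau> t where u: "u = (\<tau>, t)" by (cases u)
      have z: "Some (\<tau>, t) \<sqsubset>\<^bsub>set_poset\<^esub> Some (\<pi>', p - 1)" using that by (simp only: Some u c_def)
      then have le: "Some (\<tau>, t) \<sqsubseteq>\<^bsub>set_poset\<^esub> Some (\<pi>', p - 1)" by (simp only: set_less)
      have r: "refines N \<pi>' \<tau>" "t \<le> p - 1" "card \<tau> < card \<pi>'"
        using le set_less_card[OF z] by (simp_all add: set_le)
      show ?thesis
        using r card False by (auto simp: Some u y_def c_def s2_def)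
    qed (use that in \<open>simp add: c_def set_less adjoin_greatest_simps\<close>)
    show ?thesis
      by (rule state_stepI, rule val, rule meas, rule val2) (use cL cy rk notin eq1 eq2 in blast)+
  qed
qed

text \<open>The coatoms are the decorations of the partition into singletons, removed from the
  largest one down. Below the last one, the earlier ones cut out \<open>t < k - 1\<close>, which is
  the ideal of all merges with choice 1.\<close>

lemma set_step_top:
  assumes "0 < k" "k \<le> card N"
  shows "state_step set_poset (set_rank N) (set_valid N) set_ideal set_measure None (k, {}, {})"
proof -
  define c where "c = Some (singletons N, k - 1)"
  define s1 where "s1 = (k - 1, {} :: ('a \<times> 'a) set, {} :: ('a \<times> 'a) set)"
  define s2 where "s2 = (0::nat, {} :: ('a \<times> 'a) set, {e\<in>N \<times> N. \<not> joined (singletons N) e})"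
  note part = partition_on_singletons'[of N]
  have cL: "c \<in> carrier set_poset" using assms part by (simp add: c_def set_carrier card_singletons)
  have c_less: "c \<sqsubset>\<^bsub>set_poset\<^esub> None" by (simp add: c_def set_less adjoin_greatest_simps)
  have rk: "set_rank N None = set_rank N c + 1"
    using assms by (simp add: c_def card_singletons)
  have val: "set_valid N None s1" "set_valid N c s2" using assms by (auto simp: s1_def s2_def c_def)
  have meas: "set_measure s1 < set_measure (k, {}, {})" using assms by (simp add: s1_def)
  have notin: "\<not> set_ideal None s1 c" by (simp add: s1_def c_def)
  have eq1: "set_ideal None (k, {}, {}) z = (set_ideal None s1 z \<or> z \<sqsubseteq>\<^bsub>set_poset\<^esub> c)"
    if "z \<in> carrier set_poset" "z \<sqsubset>\<^bsub>set_poset\<^esub> None" for z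
  proof (cases z)
    case (Some u)
    obtain \<tau> t where u: "u = (\<tau>, t)" by (cases u)
    have r: "partition_on N \<tau>" "t < card \<tau>" using that by (auto simp: Some u set_carrier)
    then show ?thesis
      using singletons_refines[OF r(1)] card_partition_le[OF N(1) r(1)] assms
      by (auto simp: Some u s1_def c_def set_le card_singletons)
  qed (use that in \<open>simp add: set_less\<close>)
  have eq2: "set_ideal None s1 z = set_ideal c s2 z" if "z \<sqsubset>\<^bsub>set_poset\<^esub> c" for z
  proof (cases z)
    case (Some u)
    obtain \<tau> t where u: "u = (\<tau>, t)" by (cases u)
    have z: "Some (\<tau>, t) \<sqsubset>\<^bsub>set_poset\<^esub> Some (singletons N, k - 1)" using that by (simp only: Some u c_def)
    then have le: "Some (\<tau>, t) \<sqsubseteq>\<^bsub>set_poset\<^esub> Some (singletons N, k - 1)" by (simp only: set_less)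
    have r: "refines N (singletons N) \<tau>" "\<tau> \<noteq> singletons N"
      using le set_less_card[OF z] by (simp_all add: set_le)
    have "\<exists>f\<in>{e\<in>N \<times> N. \<not> joined (singletons N) e}. joined \<tau> f"
      using exists_newly_joined[OF N(1) r] by blast
    then show ?thesis by (auto simp: Some u s1_def c_def s2_def)
  qed (use that in \<open>simp add: c_def set_less adjoin_greatest_simps\<close>)
  show ?thesis
    by (rule state_stepI, rule val, rule meas, rule val) (use cL c_less rk notin eq1 eq2 in blast)+
qed

lemma set_ideal_states: "ideal_states set_poset (set_rank N) (set_valid N) set_ideal set_measure"
proof -
  interpret partial_order set_poset
    by (intro partial_order_adjoin_greatest partial_order_set_decorated N)
  show ?thesis
  proof unfold_locales
    fix y and s :: "nat \<times> ('a \<times> 'a) set \<times> ('a \<times> 'a) set"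
    assume y: "y \<in> carrier set_poset" and valid: "set_valid N y s"
    obtain k E0 E1 where s: "s = (k, E0, E1)" by (cases s)
    show "(\<forall>z\<in>carrier set_poset. z \<sqsubset>\<^bsub>set_poset\<^esub> y \<longrightarrow> \<not> set_ideal y s z) \<or>
      state_step set_poset (set_rank N) (set_valid N) set_ideal set_measure y s"
    proof (cases y)
      case None
      with valid have k: "k \<le> card N" "E0 = {}" "E1 = {}" by (auto simp: s)
      show ?thesis
      proof (cases "k = 0")
        case True
        have "\<not> set_ideal y s z" for z by (cases z) (auto simp: None s True)
        then show ?thesis by blast
      next
        case False
        then show ?thesis
          using set_step_top[of k] k unfolding None s by blast
      qed
    next
      case (Some v)
      obtain \<pi> p where v: "v = (\<pi>, p)" by (cases v)
      have y': "partition_on N \<pi>" "p < card \<pi>" using y by (auto simp: Some v set_carrier)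
      have E: "E0 \<subseteq> E1" "E1 \<subseteq> N \<times> N" "\<forall>e\<in>E1. \<not> joined \<pi> e"
        using valid by (auto simp: Some v s)
      consider "E1 = {}" | e where "e \<in> E0" | e where "e \<in> E1" "E0 = {}" by blast
      then show ?thesis
      proof cases
        case 1
        have "\<not> set_ideal y s z" for z using 1 E by (cases z) (auto simp: Some v s)
        then show ?thesis by blast
      next
        case (2 e)
        then have "e \<in> N \<times> N" "\<not> joined \<pi> e" using E by blast+
        then obtain A B where "merge_blocks N \<pi> A B" "joined (merge \<pi> A B) e"
          by (rule joined_merge_blocks[OF y'(1) N(1)])
        from set_step_zero[OF y'(2) E 2 this, of k] show ?thesis
          unfolding Some v s by blast
      next
        case (3 e)
        then have "e \<in> N \<times> N" "\<not> joined \<pi> e" using E by blast+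
        then obtain A B where "merge_blocks N \<pi> A B" "joined (merge \<pi> A B) e"
          by (rule joined_merge_blocks[OF y'(1) N(1)])
        from set_step_one[OF y'(2) E(2,3) 3(1) this, of k] show ?thesis
          unfolding Some v s 3(2) by blast
      qed
    qed
  qed
qed

lemma set_interval_acyclic:
  assumes x: "x \<in> carrier set_poset" and y: "y \<in> carrier set_poset" and xy: "x \<sqsubset>\<^bsub>set_poset\<^esub> y"
  shows "acyclic_below K set_poset (open_interval set_poset x y) (int (set_rank N y) - int (set_rank N x) - 2)"
proof -
  interpret ideal_states set_poset "set_rank N" "set_valid N" set_ideal set_measure
    by (rule set_ideal_states)
  show ?thesis
  proof (cases y)
    case None
    show ?thesis
    proof (rule acyclic_below_open_interval[OF x y xy])
      show "set_valid N y (card N, {}, {})" by (simp add: None)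
      show "set_ideal y (card N, {}, {}) z" if "z \<in> carrier set_poset" "z \<sqsubset>\<^bsub>set_poset\<^esub> y" for z
      proof (cases z)
        case (Some u)
        then show ?thesis
          using that card_partition_le[OF N(1), of "fst u"] by (cases u) (auto simp: None set_carrier)
      qed (use that None in \<open>simp add: set_less\<close>)
    qed
  next
    case (Some v)
    obtain \<pi> p where v: "v = (\<pi>, p)" by (cases v)
    let ?E = "{e\<in>N \<times> N. \<not> joined \<pi> e}"
    show ?thesis
    proof (rule acyclic_below_open_interval[OF x y xy])
      show "set_valid N y (0, ?E, ?E)" by (auto simp: Some v)
      show "set_ideal y (0, ?E, ?E) z" if "z \<sqsubset>\<^bsub>set_poset\<^esub> y" for z
      proof (cases z)
        case (Some u)
        obtain \<tau> t where u: "u = (\<tau>, t)" by (cases u)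
        have z: "Some (\<tau>, t) \<sqsubset>\<^bsub>set_poset\<^esub> Some (\<pi>, p)" using that by (simp only: Some u \<open>y = Some v\<close> v)
        then have "Some (\<tau>, t) \<sqsubseteq>\<^bsub>set_poset\<^esub> Some (\<pi>, p)" by (simp only: set_less)
        then have r: "refines N \<pi> \<tau>" "t \<le> p" by (simp_all add: set_le)
        have "\<exists>e\<in>?E. joined \<tau> e"
          using exists_newly_joined[OF N(1) r(1) set_less_card(1)[OF z]] by blast
        moreover have "t < p \<or> p + card \<tau> < t + card \<pi>"
          using r(2) set_less_card(2)[OF z] by linarith
        ultimately show ?thesis unfolding Some u \<open>y = Some v\<close> v set_ideal.simps by blast
      qed (use that in \<open>simp add: Some set_less adjoin_greatest_simps\<close>)
    qed
  qed
qed

lemma cohen_macaulay_set_decorated: "cohen_macaulay TYPE('k::field) set_poset"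
proof (rule cohen_macaulayI)
  show "partial_order set_poset"
    by (intro partial_order_adjoin_greatest partial_order_set_decorated N)
  have "carrier (set_decorated_partitions N) = Sigma {\<pi>. partition_on N \<pi>} (\<lambda>\<pi>. {..<card \<pi>})"
    by (auto simp: set_decorated_carrier)
  then show "finite (carrier set_poset)"
    using finitely_many_partition_on[OF N(1)] by (simp add: adjoin_greatest_simps)
  have "Some ({N}, 0) \<sqsubseteq>\<^bsub>set_poset\<^esub> x" if "x \<in> carrier set_poset" for x
  proof (cases x)
    case (Some u)
    with that show ?thesis
      using refines_single_block[OF _ N(2)] by (cases u) (simp add: set_carrier set_le)
  qed (simp add: adjoin_greatest_simps)
  then show "least set_poset (Some ({N}, 0)) (carrier set_poset)"
    using partition_on_space[OF N(2)] by (simp add: least_def set_carrier)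
  show "greatest set_poset None (carrier set_poset)"
    by (simp add: greatest_def adjoin_greatest_simps)
  show "set_rank N (Some ({N}, 0)) = 0" by simp
next
  fix x y assume xy: "x \<in> carrier set_poset" "y \<in> carrier set_poset" "x \<sqsubset>\<^bsub>set_poset\<^esub> y"
  then obtain \<sigma> q where x: "x = Some (\<sigma>, q)" by (cases x; cases y) (auto simp: set_less adjoin_greatest_simps)
  have sig: "partition_on N \<sigma>" "q < card \<sigma>" using xy by (auto simp: x set_carrier)
  show "set_rank N x < set_rank N y"
  proof (cases y)
    case None
    then show ?thesis using card_pos[OF sig(1)] card_partition_le[OF N(1) sig(1)] by (simp add: x)
  next
    case (Some v)
    then show ?thesis
      using set_less_card(2)[of \<sigma> q "fst v" "snd v"] xy sig by (cases v) (auto simp: x)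
  qed
  show "\<exists>c\<in>carrier set_poset. x \<sqsubseteq>\<^bsub>set_poset\<^esub> c \<and> c \<sqsubset>\<^bsub>set_poset\<^esub> y \<and> set_rank N y = set_rank N c + 1"
  proof (cases y)
    case None
    \<comment> \<open>The decoration \<open>q\<close> can be kept, as the order then only requires
      \<open>card \<sigma> \<le> card N\<close>.\<close>
    have "Some (singletons N, q) \<in> carrier set_poset"
      using sig card_partition_le[OF N(1) sig(1)] partition_on_singletons'[of N]
      by (auto simp: set_carrier card_singletons)
    moreover have "x \<sqsubseteq>\<^bsub>set_poset\<^esub> Some (singletons N, q)"
      using singletons_refines[OF sig(1)] card_partition_le[OF N(1) sig(1)]
      by (simp add: x set_le card_singletons)
    moreover have "0 < card N" using N by (simp add: card_gt_0_iff)
    ultimately show ?thesis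
      by (intro bexI[of _ "Some (singletons N, q)"])
        (auto simp: None set_less adjoin_greatest_simps(2) card_singletons)
  next
    case (Some v)
    obtain \<pi> p where v: "v = (\<pi>, p)" by (cases v)
    have less: "Some (\<sigma>, q) \<sqsubset>\<^bsub>set_poset\<^esub> Some (\<pi>, p)" using xy by (simp add: x Some v)
    then have "Some (\<sigma>, q) \<sqsubseteq>\<^bsub>set_poset\<^esub> Some (\<pi>, p)" by (simp only: set_less)
    then have r: "refines N \<pi> \<sigma>" "q \<le> p" "p + card \<sigma> \<le> q + card \<pi>" by (simp_all add: set_le)
    note card_less = set_less_card[OF less]
    obtain A B C where m: "merge_blocks N \<pi> A B" and C: "C \<in> \<sigma>" "A \<subseteq> C" "B \<subseteq> C"
      using coarser_merge[OF N(1) r(1) card_less(1)] .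
    interpret merge_blocks N \<pi> A B by fact
    \<comment> \<open>Choice 1 if the decorations differ; if they agree, the loss of blocks leaves
      room for choice 0.\<close>
    let ?c = "Some (merge \<pi> A B, if q < p then p - 1 else p)"
    have p: "p < card \<pi>" using xy by (simp add: Some v set_carrier)
    have "?c \<in> carrier set_poset"
      using partition_merge card_merge p r card_less sig by (auto simp: set_carrier)
    moreover have "refines N (merge \<pi> A B) \<sigma>" using merge_refines_iff r(1) C by blast
    then have "x \<sqsubseteq>\<^bsub>set_poset\<^esub> ?c"
      using card_merge r card_less by (auto simp: x set_le)
    moreover have "?c \<sqsubset>\<^bsub>set_poset\<^esub> y"
      using card_merge refines_merge by (auto simp: Some v set_less set_le)
    moreover have "set_rank N y = set_rank N ?c + 1"
      using card_merge card_pos[OF partition_merge] by (simp add: Some v)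
    ultimately show ?thesis by blast
  qed
  show "acyclic_below TYPE('k) set_poset (open_interval set_poset x y) (int (set_rank N y) - int (set_rank N x) - 2)"
    using xy by (rule set_interval_acyclic)
qed

end

section \<open>Decorations of each block\<close>

definition weight :: "'a set set \<Rightarrow> ('a set \<Rightarrow> nat) \<Rightarrow> 'a set \<Rightarrow> nat" where
  "weight \<pi> p C = (\<Sum>B\<in>blocks_in \<pi> C. p B)"

lemma block_decorated_le_iff:
  "(\<sigma>, q) \<sqsubseteq>\<^bsub>block_decorated_partitions N\<^esub> (\<pi>, p) \<longleftrightarrow> refines N \<pi> \<sigma> \<and>
    (\<forall>A\<in>\<sigma>. weight \<pi> p A \<le> q A \<and> q A < weight \<pi> p A + card (blocks_in \<pi> A))"
proof -
  have "(\<exists>r\<in>Com2 (blocks_in \<pi> A). q A = Com2_comp (blocks_in \<pi> A) r p) \<longleftrightarrow>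
    weight \<pi> p A \<le> q A \<and> q A < weight \<pi> p A + card (blocks_in \<pi> A)" for A
  proof
    assume r: "weight \<pi> p A \<le> q A \<and> q A < weight \<pi> p A + card (blocks_in \<pi> A)"
    then show "\<exists>r\<in>Com2 (blocks_in \<pi> A). q A = Com2_comp (blocks_in \<pi> A) r p"
      by (intro bexI[of _ "q A - weight \<pi> p A"]) (auto simp: Com2_def Com2_comp_def weight_def)
  qed (auto simp: Com2_def Com2_comp_def weight_def)
  then show ?thesis by (simp add: block_decorated_partitions_def)
qed

lemma block_decorated_carrier:
  "(\<pi>, p) \<in> carrier (block_decorated_partitions N) \<longleftrightarrow>
    partition_on N \<pi> \<and> (\<forall>B\<in>\<pi>. p B < card B) \<and> p \<in> extensional \<pi>"
  by (auto simp: block_decorated_partitions_def Com2_def PiE_def Pi_def)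

lemma weight_block:
  assumes "partition_on N \<pi>" "B \<in> \<pi>"
  shows "weight \<pi> p B = p B"
  by (simp add: weight_def blocks_in_block[OF assms])

text \<open>Each block contains just itself, so its bounds leave a single value; extensionality then
  identifies the functions.\<close>

lemma block_decorated_le_same_partition:
  assumes "(\<pi>, q) \<sqsubseteq>\<^bsub>block_decorated_partitions N\<^esub> (\<pi>, p)"
    and "(\<pi>, q) \<in> carrier (block_decorated_partitions N)" "(\<pi>, p) \<in> carrier (block_decorated_partitions N)"
  shows "q = p"
proof (rule extensionalityI[of _ \<pi>])
  have part: "partition_on N \<pi>" using assms(3) by (simp add: block_decorated_carrier)
  show "q A = p A" if "A \<in> \<pi>" for A
    using assms(1) that
    by (fastforce simp: block_decorated_le_iff weight_block[OF part] blocks_in_block[OF part])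
qed (use assms in \<open>simp_all add: block_decorated_carrier\<close>)

lemma partial_order_block_decorated:
  assumes N: "finite N"
  shows "partial_order (block_decorated_partitions N)"
proof (rule partial_order_eqI)
  let ?L = "block_decorated_partitions N"
  show "eq ?L = (=)" by (simp add: block_decorated_partitions_def)
  show "x \<sqsubseteq>\<^bsub>?L\<^esub> x" if "x \<in> carrier ?L" for x
  proof (cases x)
    case (Pair \<pi> p)
    then have "partition_on N \<pi>" using that by (simp add: block_decorated_carrier)
    then show ?thesis
      by (simp add: Pair block_decorated_le_iff refines_refl weight_block blocks_in_block)
  qed
  show "x = y" if "x \<in> carrier ?L" "y \<in> carrier ?L" "x \<sqsubseteq>\<^bsub>?L\<^esub> y" "y \<sqsubseteq>\<^bsub>?L\<^esub> x" for x y
  proof -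
    have "fst x = fst y"
      using that(3,4) refines_asym by (cases x; cases y) (auto simp: block_decorated_le_iff)
    then show ?thesis
      using block_decorated_le_same_partition[of N "fst x" "snd x" "snd y"] that
      by (cases x; cases y) simp
  qed
  show "x \<sqsubseteq>\<^bsub>?L\<^esub> z" if xy: "x \<sqsubseteq>\<^bsub>?L\<^esub> y" and yz: "y \<sqsubseteq>\<^bsub>?L\<^esub> z" for x y z
  proof -
    obtain \<rho> s \<sigma> q \<pi> p where x: "x = (\<rho>, s)" and y: "y = (\<sigma>, q)" and z: "z = (\<pi>, p)"
      by (cases x; cases y; cases z)
    have r: "refines N \<sigma> \<rho>" "refines N \<pi> \<sigma>"
      using xy yz by (auto simp: x y z block_decorated_le_iff)
    have "weight \<pi> p D \<le> s D \<and> s D < weight \<pi> p D + card (blocks_in \<pi> D)" if D: "D \<in> \<rho>" for D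
    proof -
      have in_\<sigma>: "C \<in> \<sigma>" if "C \<in> blocks_in \<sigma> D" for C using that by (simp add: blocks_in_def)
      have q: "weight \<pi> p C \<le> q C" "q C + 1 \<le> weight \<pi> p C + card (blocks_in \<pi> C)"
        if "C \<in> blocks_in \<sigma> D" for C
        using yz in_\<sigma>[OF that] by (auto simp: y z block_decorated_le_iff Suc_le_eq)
      have w: "(\<Sum>C\<in>blocks_in \<sigma> D. weight \<pi> p C) = weight \<pi> p D"
        unfolding weight_def by (rule sum_blocks_in_nested[OF N r(2,1) D])
      have c: "(\<Sum>C\<in>blocks_in \<sigma> D. card (blocks_in \<pi> C)) = card (blocks_in \<pi> D)"
        by (rule card_blocks_in_nested[OF N r(2,1) D])
      have lower: "weight \<pi> p D \<le> weight \<sigma> q D"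
        unfolding w[symmetric] weight_def[of \<sigma>] by (rule sum_mono) (rule q)
      \<comment> \<open>The 1 from each block adds up to \<open>card (blocks_in \<sigma> D)\<close>,
        which pays for the excess of \<open>s D\<close> over
        \<open>weight \<sigma> q D\<close>.\<close>
      have "(\<Sum>C\<in>blocks_in \<sigma> D. q C + 1) \<le>
          (\<Sum>C\<in>blocks_in \<sigma> D. weight \<pi> p C + card (blocks_in \<pi> C))"
        by (rule sum_mono) (rule q)
      then have "weight \<sigma> q D + card (blocks_in \<sigma> D) \<le> weight \<pi> p D + card (blocks_in \<pi> D)"
        unfolding sum.distrib w c card_sum_one[symmetric] weight_def[of \<sigma>] .
      moreover have "weight \<sigma> q D \<le> s D" "s D < weight \<sigma> q D + card (blocks_in \<sigma> D)"
        using xy D by (auto simp: x y block_decorated_le_iff)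
      ultimately show ?thesis using lower by linarith
    qed
    moreover have "refines N \<pi> \<rho>" using refines_trans[OF r(2,1)] .
    ultimately show ?thesis by (simp add: x z block_decorated_le_iff)
  qed
qed

text \<open>Here \<open>u\<close> is the decoration of the two-element set of merged blocks, hence 0
  or 1. The restriction yields the extensional representative demanded by the carrier.\<close>

definition merge_decoration ::
    "'a set set \<Rightarrow> ('a set \<Rightarrow> nat) \<Rightarrow> 'a set \<Rightarrow> 'a set \<Rightarrow> nat \<Rightarrow> 'a set \<Rightarrow> nat" where
  "merge_decoration \<pi> p A B u =
     restrict (\<lambda>D. if D = A \<union> B then p A + p B + u else p D) (merge \<pi> A B)"

context merge_blocks
begin

lemma weight_merge:
  assumes "A \<subseteq> C" "B \<subseteq> C"
  shows "weight (merge \<pi> A B) (merge_decoration \<pi> p A B u) C = weight \<pi> p C + u"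
proof -
  let ?f = "\<lambda>D. if D = A \<union> B then p A + p B + u else p D"
  have "weight (merge \<pi> A B) (merge_decoration \<pi> p A B u) C = (\<Sum>D\<in>blocks_in (merge \<pi> A B) C. ?f D)"
    unfolding weight_def merge_decoration_def
    by (rule sum.cong) (simp_all add: blocks_in_def)
  moreover have "weight \<pi> p C = (\<Sum>D\<in>blocks_in \<pi> C. ?f D)"
    unfolding weight_def by (rule sum.cong) (use union_notin in \<open>auto simp: blocks_in_def\<close>)
  moreover have "?f A = p A" "?f B = p B" using union_notin A B by metis+
  ultimately show ?thesis
    using sum_blocks_in_merge[OF assms, of ?f] by simp
qed

lemma weight_merge_other:
  assumes "refines N (merge \<pi> A B) \<tau>" "C \<in> \<tau>" "\<not> A \<subseteq> C"
  shows "weight (merge \<pi> A B) (merge_decoration \<pi> p A B u) C = weight \<pi> p C"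
  unfolding weight_def blocks_in_merge_other[OF assms]
proof (rule sum.cong)
  fix D assume D: "D \<in> blocks_in \<pi> C"
  then have "D \<in> merge \<pi> A B"
    using blocks_in_merge_other[OF assms] by (auto simp: blocks_in_def)
  moreover have "D \<noteq> A \<union> B" using D union_notin by (auto simp: blocks_in_def)
  ultimately show "merge_decoration \<pi> p A B u D = p D" by (simp add: merge_decoration_def)
qed simp

text \<open>Only the block \<open>C\<close> above \<open>A\<close> and \<open>B\<close> notices the
  merge: its weight grows by \<open>u\<close> and its number of blocks drops by one. For
  \<open>u = 0\<close> this tightens the upper bound on \<open>q C\<close>, for \<open>u = 1\<close>
  the lower one.\<close>

lemma merge_le_iff:
  assumes u: "u \<le> 1"
  shows "(\<tau>, q) \<sqsubseteq>\<^bsub>block_decorated_partitions N\<^esub> (merge \<pi> A B, merge_decoration \<pi> p A B u) \<longleftrightarrow>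
    (\<tau>, q) \<sqsubseteq>\<^bsub>block_decorated_partitions N\<^esub> (\<pi>, p) \<and>
    (\<exists>C\<in>\<tau>. A \<subseteq> C \<and> B \<subseteq> C \<and> weight \<pi> p C + u \<le> q C \<and>
      q C + 1 < weight \<pi> p C + u + card (blocks_in \<pi> C))" (is "?l \<longleftrightarrow> ?r \<and> ?m")
proof (cases "refines N (merge \<pi> A B) \<tau>")
  case True
  then obtain C where C: "C \<in> \<tau>" "A \<subseteq> C" "B \<subseteq> C" and r: "refines N \<pi> \<tau>"
    by (auto simp: merge_refines_iff)
  obtain a where a: "a \<in> A" using nonempty by blast
  have only: "D = C" if "D \<in> \<tau>" "A \<subseteq> D" for D
    using partition_on_same_block[of N \<tau> D C a] that C a r by (auto simp: refines_def)
  let ?w' = "weight (merge \<pi> A B) (merge_decoration \<pi> p A B u)"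
  have other: "?w' D \<le> q D \<and> q D < ?w' D + card (blocks_in (merge \<pi> A B) D) \<longleftrightarrow>
      weight \<pi> p D \<le> q D \<and> q D < weight \<pi> p D + card (blocks_in \<pi> D)" if "D \<in> \<tau>" "D \<noteq> C" for D
  proof -
    have "\<not> A \<subseteq> D" using only[OF that(1)] that(2) by blast
    then show ?thesis
      by (simp add: weight_merge_other[OF True that(1)] blocks_in_merge_other[OF True that(1)])
  qed
  have at_C: "?w' C \<le> q C \<and> q C < ?w' C + card (blocks_in (merge \<pi> A B) C) \<longleftrightarrow>
      weight \<pi> p C + u \<le> q C \<and> q C + 1 < weight \<pi> p C + u + card (blocks_in \<pi> C)"
    using card_blocks_in_merge[OF C(2,3)] by (auto simp: weight_merge[OF C(2,3)])
  have m: "?m \<longleftrightarrow> weight \<pi> p C + u \<le> q C \<and> q C + 1 < weight \<pi> p C + u + card (blocks_in \<pi> C)"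
    using C only by blast
  have C_imp: "weight \<pi> p C + u \<le> q C \<and> q C + 1 < weight \<pi> p C + u + card (blocks_in \<pi> C) \<Longrightarrow>
      weight \<pi> p C \<le> q C \<and> q C < weight \<pi> p C + card (blocks_in \<pi> C)"
    using u by linarith
  show ?thesis
    unfolding block_decorated_le_iff m
    using True r other at_C C_imp C(1) by blast
next
  case False
  then show ?thesis
    unfolding block_decorated_le_iff merge_refines_iff by blast
qed

text \<open>The extreme values fit exactly:
  \<open>(card A - 1) + (card B - 1) + 1 = card (A \<union> B) - 1\<close>.\<close>

lemma merge_decoration_carrier:
  assumes "(\<pi>, p) \<in> carrier (block_decorated_partitions N)" "u \<le> 1"
  shows "(merge \<pi> A B, merge_decoration \<pi> p A B u) \<in> carrier (block_decorated_partitions N)"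
proof -
  have p: "p D < card D" if "D \<in> \<pi>" for D using assms(1) that by (simp add: block_decorated_carrier)
  have "A \<subseteq> N" "B \<subseteq> N" using A B part by (auto simp: partition_on_def)
  then have "finite A" "finite B" using N finite_subset by blast+
  then have "card (A \<union> B) = card A + card B"
    using disjoint[OF A B AB] by (simp add: card_Un_disjoint)
  then have "p A + p B + u < card (A \<union> B)" using p[OF A] p[OF B] assms(2) by linarith
  moreover have "p D < card D" if "D \<in> merge \<pi> A B" "D \<noteq> A \<union> B" for D
    using that p by (auto simp: merge_def)
  ultimately show ?thesis
    using partition_merge by (simp add: block_decorated_carrier merge_decoration_def)
qed

end

text \<open>A state \<open>(F, A, E\<^sub>0, E\<^sub>1)\<close> of \<open>(\<pi>, p)\<close> stands for all merges involving a block inside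
  \<open>F\<close>, together with the merges of \<open>A\<close> with the blocks meeting \<open>E\<^sub>0\<close> or \<open>E\<^sub>1\<close> whose decoration
  exceeds the sum by \<open>0\<close> or \<open>1\<close>, respectively. Merges in general position do not form a
  recursive atom ordering here, so all the merges of one block are added before the next one.\<close>

fun block_valid :: "'a set \<Rightarrow> ('a set set \<times> ('a set \<Rightarrow> nat)) option \<Rightarrow>
    'a set \<times> 'a set \<times> 'a set \<times> 'a set \<Rightarrow> bool" where
  "block_valid N None s \<longleftrightarrow> True"
| "block_valid N (Some (\<pi>, p)) (F, A, E0, E1) \<longleftrightarrow>
     A \<in> \<pi> \<and> F \<subseteq> N \<and> F \<inter> A = {} \<and> (\<forall>B\<in>\<pi>. B \<subseteq> F \<or> F \<inter> B = {}) \<and> E0 \<subseteq> E1 \<and> E1 \<subseteq> N - F - A"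

text \<open>The least element belongs to the ideal iff there is any generator; \<open>E1\<close>
  suffices for this test since \<open>E0 \<subseteq> E1\<close>. The clause for \<open>F\<close>
  mentions no decoration, because a block outside \<open>\<pi>\<close> always leaves room for one of
  the two choices.\<close>

fun block_ideal :: "('a set set \<times> ('a set \<Rightarrow> nat)) option \<Rightarrow> 'a set \<times> 'a set \<times> 'a set \<times> 'a set \<Rightarrow>
    ('a set set \<times> ('a set \<Rightarrow> nat)) option \<Rightarrow> bool" where
  "block_ideal None s z \<longleftrightarrow> False"
| "block_ideal (Some y) (F, A, E0, E1) None \<longleftrightarrow> F \<noteq> {} \<or> E1 \<noteq> {}"
| "block_ideal (Some (\<pi>, p)) (F, A, E0, E1) (Some (\<tau>, q)) \<longleftrightarrow>
     (\<exists>C\<in>\<tau>. C \<notin> \<pi> \<and> C \<inter> F \<noteq> {}) \<or>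
     (\<exists>C\<in>\<tau>. A \<subseteq> C \<and> (weight \<pi> p C < q C \<and> C \<inter> E1 \<noteq> {} \<or>
        q C + 1 < weight \<pi> p C + card (blocks_in \<pi> C) \<and> C \<inter> E0 \<noteq> {}))"

text \<open>The factor exceeds what \<open>E0\<close> and \<open>E1\<close> can hold together, so
  taking one block out of \<open>F\<close> pays for refilling both.\<close>

fun block_measure :: "'a set \<Rightarrow> 'a set \<times> 'a set \<times> 'a set \<times> 'a set \<Rightarrow> nat" where
  "block_measure N (F, A, E0, E1) = card F * (2 * card N + 1) + card E0 + card E1"

fun block_rank :: "('a set set \<times> ('a set \<Rightarrow> nat)) option \<Rightarrow> nat" where
  "block_rank None = 0"
| "block_rank (Some (\<pi>, p)) = card \<pi>"

lemma block_ideal_at: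
  assumes "refines N \<pi> \<tau>" "A \<in> \<pi>" "C \<in> \<tau>" "A \<subseteq> C"
  shows "block_ideal (Some (\<pi>, p)) (F, A, E0, E1) (Some (\<tau>, q)) \<longleftrightarrow>
     (\<exists>C\<in>\<tau>. C \<notin> \<pi> \<and> C \<inter> F \<noteq> {}) \<or> weight \<pi> p C < q C \<and> C \<inter> E1 \<noteq> {} \<or>
        q C + 1 < weight \<pi> p C + card (blocks_in \<pi> C) \<and> C \<inter> E0 \<noteq> {}"
proof -
  have part: "partition_on N \<pi>" "partition_on N \<tau>" using assms(1) by (auto simp: refines_def)
  obtain a where "a \<in> A" using partition_on_elem[OF part(1) assms(2)] .
  then have "D = C" if "D \<in> \<tau>" "A \<subseteq> D" for D
    using partition_on_same_block[OF part(2), of D C a] that assms by blast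
  then have "(\<exists>D\<in>\<tau>. A \<subseteq> D \<and> Q D) \<longleftrightarrow> Q C" for Q using assms(3,4) by blast
  then show ?thesis by simp
qed

abbreviation "block_poset N \<equiv> adjoin_least (block_decorated_partitions N)"

lemma block_carrier:
  "Some y \<in> carrier (block_poset N) \<longleftrightarrow> y \<in> carrier (block_decorated_partitions N)"
  "None \<in> carrier (block_poset N)"
  by (auto simp: adjoin_least_simps)

lemmas block_le = adjoin_least_simps(2-4)
lemmas block_less = adjoin_least_simps(5)

lemma block_less_card:
  assumes "finite N" "Some (\<tau>, q) \<sqsubset>\<^bsub>block_poset N\<^esub> Some (\<pi>, p)"
    and "Some (\<tau>, q) \<in> carrier (block_poset N)" "Some (\<pi>, p) \<in> carrier (block_poset N)"
  shows "refines N \<pi> \<tau>" "\<tau> \<noteq> \<pi>" "card \<tau> < card \<pi>"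
proof -
  have le: "(\<tau>, q) \<sqsubseteq>\<^bsub>block_decorated_partitions N\<^esub> (\<pi>, p)" and ne: "(\<tau>, q) \<noteq> (\<pi>, p)"
    using assms(2) by (auto simp: block_less block_le)
  show r: "refines N \<pi> \<tau>" using le by (simp add: block_decorated_le_iff)
  show "\<tau> \<noteq> \<pi>"
  proof
    assume "\<tau> = \<pi>"
    then have "q = p"
      using le assms(3,4) by (intro block_decorated_le_same_partition) (simp_all add: block_carrier)
    with \<open>\<tau> = \<pi>\<close> ne show False by simp
  qed
  then show "card \<tau> < card \<pi>" using refines_card_less[OF assms(1) r] by blast
qed

section \<open>Removing one coatom when each block is decorated\<close>

locale block_step = merge_blocks N \<pi> A B for N :: "'a set" and \<pi> A B +
  fixes p :: "'a set \<Rightarrow> nat" and F E0 E1 :: "'a set"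
  assumes y_carrier: "(\<pi>, p) \<in> carrier (block_decorated_partitions N)"
    and valid: "block_valid N (Some (\<pi>, p)) (F, A, E0, E1)"
    and B_E1: "B \<inter> E1 \<noteq> {}"
begin

lemma F: "F \<subseteq> N" "F \<inter> A = {}" "F \<inter> B = {}" "\<And>D. D \<in> \<pi> \<Longrightarrow> D \<subseteq> F \<or> F \<inter> D = {}"
proof -
  show "F \<subseteq> N" "F \<inter> A = {}" "\<And>D. D \<in> \<pi> \<Longrightarrow> D \<subseteq> F \<or> F \<inter> D = {}"
    using valid by auto
  then have "B \<subseteq> F \<or> F \<inter> B = {}" using B by blast
  moreover have "E1 \<inter> F = {}" using valid by auto
  ultimately show "F \<inter> B = {}" using B_E1 by blast
qed

lemma E: "E0 \<subseteq> E1" "E1 \<subseteq> N - F - A"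
  using valid by auto

lemma finite_E: "finite E0" "finite E1"
proof -
  show "finite E1" using finite_subset[OF E(2)] N by simp
  then show "finite E0" using finite_subset[OF E(1)] by simp
qed

abbreviation "y \<equiv> Some (\<pi>, p)"
abbreviation "c u \<equiv> Some (merge \<pi> A B, merge_decoration \<pi> p A B u)"

lemma c_carrier: "u \<le> 1 \<Longrightarrow> c u \<in> carrier (block_poset N)"
  using merge_decoration_carrier[OF y_carrier] by (simp add: block_carrier)

lemma le_c_iff:
  assumes "u \<le> 1"
  shows "Some (\<tau>, q) \<sqsubseteq>\<^bsub>block_poset N\<^esub> c u \<longleftrightarrow> Some (\<tau>, q) \<sqsubseteq>\<^bsub>block_poset N\<^esub> y \<and>
    (\<exists>C\<in>\<tau>. A \<subseteq> C \<and> B \<subseteq> C \<and> weight \<pi> p C + u \<le> q C \<and>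
      q C + 1 < weight \<pi> p C + u + card (blocks_in \<pi> C))"
  by (simp add: block_le merge_le_iff[OF assms])

lemma c_less_y:
  assumes "u \<le> 1"
  shows "c u \<sqsubset>\<^bsub>block_poset N\<^esub> y"
proof -
  interpret P: partial_order "block_poset N"
    by (intro partial_order_adjoin_least partial_order_block_decorated N)
  \<comment> \<open>Reflexivity, read through \<open>le_c_iff\<close>, contains the comparison with
    \<open>y\<close>.\<close>
  have "c u \<sqsubseteq>\<^bsub>block_poset N\<^esub> c u" using c_carrier[OF assms] by (rule P.le_refl)
  then have "c u \<sqsubseteq>\<^bsub>block_poset N\<^esub> y" unfolding le_c_iff[OF assms] by blast
  moreover have "c u \<noteq> y" using union_notin by (auto simp: merge_def)
  ultimately show ?thesis by (simp add: block_less)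
qed

lemma rank_c: "block_rank y = block_rank (c u) + 1"
  using card_merge by simp

text \<open>\<open>A\<close> and \<open>B\<close> avoid \<open>F\<close>, so the part of the ideal
  due to \<open>F\<close> is the same for \<open>y\<close> and for \<open>c u\<close>.\<close>

lemma newly_merged_iff:
  "(\<exists>D\<in>\<tau>. D \<notin> merge \<pi> A B \<and> D \<inter> F \<noteq> {}) \<longleftrightarrow> (\<exists>D\<in>\<tau>. D \<notin> \<pi> \<and> D \<inter> F \<noteq> {})"
proof -
  have "D \<in> merge \<pi> A B \<longleftrightarrow> D \<in> \<pi>" if "D \<inter> F \<noteq> {}" for D
    using that F(2,3) unfolding merge_def by blast
  then show ?thesis by blast
qed

lemma valid_c:
  assumes "G0 \<subseteq> G1" "G1 \<subseteq> N - F - (A \<union> B)"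
  shows "block_valid N (c u) (F, A \<union> B, G0, G1)"
proof -
  have "D \<subseteq> F \<or> F \<inter> D = {}" if "D \<in> merge \<pi> A B" for D
    using that F(2-4) unfolding merge_def by blast
  moreover have "F \<inter> (A \<union> B) = {}" using F(2,3) by blast
  ultimately show ?thesis using assms F(1) by (simp add: merge_def)
qed

text \<open>For \<open>u = 0\<close> the merged block attains its lower bound, which rules out a
  contribution of \<open>G1\<close>; for \<open>u = 1\<close> the set \<open>G1\<close> misses the
  merged block, and \<open>G0\<close> always does.\<close>

lemma not_ideal_c:
  assumes G: "A \<inter> G1 = {}" "G0 \<inter> (A \<union> B) = {}" and u: "u = 0 \<or> G1 \<inter> B = {}"
  shows "\<not> block_ideal y (F, A, G0, G1) (c u)"
proof -
  have AB_in: "A \<union> B \<in> merge \<pi> A B" by (simp add: merge_def)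
  have "weight \<pi> p (A \<union> B) + u = merge_decoration \<pi> p A B u (A \<union> B)"
    using weight_merge[of "A \<union> B" p u] weight_block[OF partition_merge AB_in] by simp
  moreover have "\<not> (\<exists>C\<in>merge \<pi> A B. C \<notin> \<pi> \<and> C \<inter> F \<noteq> {})"
    using F(2,3) unfolding merge_def by blast
  ultimately show ?thesis
    unfolding block_ideal_at[OF refines_merge A AB_in Un_upper1]
    using G u by auto
qed

text \<open>Below, \<open>C\<close> is the block of \<open>\<tau>\<close> containing \<open>A\<close>, \<open>w\<close> is the total decoration in \<open>\<pi>\<close> inside \<open>C\<close>,
  \<open>k\<close> is the number of blocks inside \<open>C\<close>, of \<open>merge \<pi> A B\<close> in the first lemma and of \<open>\<pi>\<close> in the
  second, and \<open>M\<close> says that a block involving \<open>F\<close> has been merged.\<close>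

lemma below_c_cases:
  assumes u: "u \<le> 1" and le: "Some (\<tau>, q) \<sqsubseteq>\<^bsub>block_poset N\<^esub> c u"
  obtains C w k M where "A \<subseteq> C" "B \<subseteq> C"
    and "w + u \<le> q C" "q C < w + u + k"
    and "C = A \<union> B \<or> M \<or> C \<inter> (N - F - (A \<union> B)) \<noteq> {}"
    and "if C = A \<union> B then k = 1 else k \<ge> 2"
    and "\<forall>G0 G1. block_ideal y (F, A, G0, G1) (Some (\<tau>, q)) \<longleftrightarrow>
      M \<or> w < q C \<and> C \<inter> G1 \<noteq> {} \<or> q C < w + k \<and> C \<inter> G0 \<noteq> {}"
    and "\<forall>G0 G1. block_ideal (c u) (F, A \<union> B, G0, G1) (Some (\<tau>, q)) \<longleftrightarrow>
      M \<or> w + u < q C \<and> C \<inter> G1 \<noteq> {} \<or> q C + 1 < w + u + k \<and> C \<inter> G0 \<noteq> {}"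
proof -
  from le obtain C where C: "C \<in> \<tau>" "A \<subseteq> C" "B \<subseteq> C"
    and bounds: "weight \<pi> p C + u \<le> q C" "q C + 1 < weight \<pi> p C + u + card (blocks_in \<pi> C)"
    unfolding le_c_iff[OF u] by blast
  have r': "refines N (merge \<pi> A B) \<tau>" using le by (simp add: block_le block_decorated_le_iff)
  then have r: "refines N \<pi> \<tau>" by (simp add: merge_refines_iff)
  let ?k = "card (blocks_in (merge \<pi> A B) C)"
  let ?M = "\<exists>D\<in>\<tau>. D \<notin> \<pi> \<and> D \<inter> F \<noteq> {}"
  have k: "card (blocks_in \<pi> C) = Suc ?k" by (rule card_blocks_in_merge[OF C(2,3)])
  have AB_in: "A \<union> B \<in> merge \<pi> A B" by (simp add: merge_def)
  have C_notin: "C \<notin> merge \<pi> A B" if "C \<noteq> A \<union> B"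
  proof
    assume "C \<in> merge \<pi> A B"
    moreover obtain a where "a \<in> A" using nonempty by blast
    ultimately show False
      using partition_on_same_block[OF partition_merge _ AB_in, of C a] C(2) that by blast
  qed
  show thesis
  proof (rule that[of C "weight \<pi> p C" ?k ?M])
    show "A \<subseteq> C" "B \<subseteq> C" by fact+
    show "weight \<pi> p C + u \<le> q C" by fact
    show "q C < weight \<pi> p C + u + ?k" using bounds(2) k by simp
    show "if C = A \<union> B then ?k = 1 else 2 \<le> ?k"
    proof (cases "C = A \<union> B")
      case True
      then show ?thesis by (simp add: blocks_in_block[OF partition_merge AB_in])
    next
      case False
      then show ?thesis using card_blocks_in_gt_one[OF N r' C(1) C_notin[OF False]] by simp
    qed
    show "C = A \<union> B \<or> ?M \<or> C \<inter> (N - F - (A \<union> B)) \<noteq> {}"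
    proof (cases "C = A \<union> B")
      case False
      then obtain d where d: "d \<in> C" "d \<notin> A \<union> B" using C(2,3) by blast
      have "d \<in> N" using d C(1) r by (auto simp: refines_def partition_on_def)
      moreover have ?M if "d \<in> F"
        using C_notin[OF False] newly_merged_iff[of \<tau>] that d(1) C(1) by blast
      ultimately show ?thesis using d by blast
    qed simp
    show "\<forall>G0 G1. block_ideal y (F, A, G0, G1) (Some (\<tau>, q)) \<longleftrightarrow>
      ?M \<or> weight \<pi> p C < q C \<and> C \<inter> G1 \<noteq> {} \<or> q C < weight \<pi> p C + ?k \<and> C \<inter> G0 \<noteq> {}"
      unfolding block_ideal_at[OF r A C(1,2)] k by simp
    have AB_C: "A \<union> B \<subseteq> C" using C by simp
    show "\<forall>G0 G1. block_ideal (c u) (F, A \<union> B, G0, G1) (Some (\<tau>, q)) \<longleftrightarrow>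
      ?M \<or> weight \<pi> p C + u < q C \<and> C \<inter> G1 \<noteq> {} \<or>
        q C + 1 < weight \<pi> p C + u + ?k \<and> C \<inter> G0 \<noteq> {}"
      unfolding block_ideal_at[OF r' AB_in C(1) AB_C] newly_merged_iff weight_merge[OF C(2,3)] by simp
  qed
qed

lemma below_y_cases:
  assumes le: "Some (\<tau>, q) \<sqsubseteq>\<^bsub>block_poset N\<^esub> y"
  obtains C w k M where "w \<le> q C" "q C < w + k"
    and "\<forall>x\<in>B. x \<in> C \<longleftrightarrow> B \<subseteq> C"
    and "\<forall>G0 G1. block_ideal y (F, A, G0, G1) (Some (\<tau>, q)) \<longleftrightarrow>
      M \<or> w < q C \<and> C \<inter> G1 \<noteq> {} \<or> q C + 1 < w + k \<and> C \<inter> G0 \<noteq> {}"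
    and "\<forall>u\<le>1. Some (\<tau>, q) \<sqsubseteq>\<^bsub>block_poset N\<^esub> c u \<longleftrightarrow>
      B \<subseteq> C \<and> w + u \<le> q C \<and> q C + 1 < w + u + k"
proof -
  have le': "(\<tau>, q) \<sqsubseteq>\<^bsub>block_decorated_partitions N\<^esub> (\<pi>, p)" using le by (simp add: block_le)
  then have r: "refines N \<pi> \<tau>" by (simp add: block_decorated_le_iff)
  then have part': "partition_on N \<tau>" by (simp add: refines_def)
  from r obtain C where C: "C \<in> \<tau>" "A \<subseteq> C" using A by (auto simp: refines_def)
  obtain a where a: "a \<in> A" using nonempty by blast
  have only: "D = C" if "D \<in> \<tau>" "A \<subseteq> D" for D
    using partition_on_same_block[OF part' that(1) C(1), of a] that(2) C(2) a by blast
  show thesis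
  proof (rule that[of "weight \<pi> p C" C "card (blocks_in \<pi> C)" "\<exists>C\<in>\<tau>. C \<notin> \<pi> \<and> C \<inter> F \<noteq> {}"])
    show "weight \<pi> p C \<le> q C" "q C < weight \<pi> p C + card (blocks_in \<pi> C)"
      using le' C(1) by (auto simp: block_decorated_le_iff)
    show "\<forall>x\<in>B. x \<in> C \<longleftrightarrow> B \<subseteq> C"
      using refines_block_subset[OF r B C(1)] by blast
    show "\<forall>G0 G1. block_ideal y (F, A, G0, G1) (Some (\<tau>, q)) \<longleftrightarrow> (\<exists>C\<in>\<tau>. C \<notin> \<pi> \<and> C \<inter> F \<noteq> {}) \<or>
        weight \<pi> p C < q C \<and> C \<inter> G1 \<noteq> {} \<or>
        q C + 1 < weight \<pi> p C + card (blocks_in \<pi> C) \<and> C \<inter> G0 \<noteq> {}"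
      by (intro allI block_ideal_at[OF r A C])
    show "\<forall>u\<le>1. Some (\<tau>, q) \<sqsubseteq>\<^bsub>block_poset N\<^esub> c u \<longleftrightarrow> B \<subseteq> C \<and> weight \<pi> p C + u \<le> q C \<and>
        q C + 1 < weight \<pi> p C + u + card (blocks_in \<pi> C)"
    proof (intro allI impI)
      fix u :: nat assume "u \<le> 1"
      then show "Some (\<tau>, q) \<sqsubseteq>\<^bsub>block_poset N\<^esub> c u \<longleftrightarrow> B \<subseteq> C \<and> weight \<pi> p C + u \<le> q C \<and>
          q C + 1 < weight \<pi> p C + u + card (blocks_in \<pi> C)"
        unfolding le_c_iff[OF \<open>u \<le> 1\<close>] using le C only by blast
    qed
  qed
qed

text \<open>Below \<open>c 0\<close> the inequality of choice 0 is strict relative to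
  \<open>y\<close>, and \<open>C\<close> meets \<open>E1\<close> through \<open>B\<close>. So the
  old ideal means \<open>M\<close>, or \<open>w < q C\<close>, or that \<open>C\<close> meets
  \<open>E0 - B\<close>. If \<open>w < q C\<close>, then \<open>C\<close> is larger than
  \<open>A \<union> B\<close>, and either \<open>M\<close> holds or \<open>C\<close> meets
  \<open>N - F - (A \<union> B)\<close>; hence that set as last component. If
  \<open>q C = w\<close>, only \<open>M\<close> and \<open>E0 - B\<close> matter on both
  sides.\<close>

lemma state_step_zero:
  assumes B_E0: "B \<inter> E0 \<noteq> {}"
  shows "state_step (block_poset N) block_rank (block_valid N) block_ideal (block_measure N)
    y (F, A, E0, E1)"
proof -
  let ?s1 = "(F, A, E0 - B, E1)" and ?s2 = "(F, A \<union> B, E0 - B, N - F - (A \<union> B))"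
  have "card (E0 - B) < card E0"
    using B_E0 finite_E by (intro psubset_card_mono) auto
  then have meas: "block_measure N ?s1 < block_measure N (F, A, E0, E1)" by simp
  have val: "block_valid N y ?s1" using valid by auto
  have val2: "block_valid N (c 0) ?s2" using E by (intro valid_c) auto
  have notin: "\<not> block_ideal y ?s1 (c 0)" using E by (intro not_ideal_c) auto
  have eq1: "block_ideal y (F, A, E0, E1) z = (block_ideal y ?s1 z \<or> z \<sqsubseteq>\<^bsub>block_poset N\<^esub> c 0)"
    if "z \<sqsubset>\<^bsub>block_poset N\<^esub> y" for z
  proof (cases z)
    case None
    then show ?thesis using B_E1 by (auto simp: block_le)
  next
    case (Some v)
    obtain \<tau> q where v: "v = (\<tau>, q)" by (cases v)
    have le: "Some (\<tau>, q) \<sqsubseteq>\<^bsub>block_poset N\<^esub> y" using that by (simp only: Some v block_less)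
    obtain C w k M where wk: "w \<le> q C" "q C < w + k"
      and BC: "\<forall>x\<in>B. x \<in> C \<longleftrightarrow> B \<subseteq> C"
      and ideal: "\<forall>G0 G1. block_ideal y (F, A, G0, G1) (Some (\<tau>, q)) \<longleftrightarrow>
        M \<or> w < q C \<and> C \<inter> G1 \<noteq> {} \<or> q C + 1 < w + k \<and> C \<inter> G0 \<noteq> {}"
      and c: "\<forall>u\<le>1. Some (\<tau>, q) \<sqsubseteq>\<^bsub>block_poset N\<^esub> c u \<longleftrightarrow>
        B \<subseteq> C \<and> w + u \<le> q C \<and> q C + 1 < w + u + k"
      by (rule below_y_cases[OF le])
    have "C \<inter> E0 \<noteq> {} \<longleftrightarrow> C \<inter> (E0 - B) \<noteq> {} \<or> B \<subseteq> C" using B_E0 BC by blast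
    then show ?thesis unfolding Some v ideal[rule_format] using c[rule_format, of 0] wk by auto
  qed
  have eq2: "block_ideal y ?s1 z = block_ideal (c 0) ?s2 z"
    if z: "z \<sqsubset>\<^bsub>block_poset N\<^esub> c 0"
      "(\<exists>w\<in>carrier (block_poset N). w \<sqsubset>\<^bsub>block_poset N\<^esub> z) \<or> block_rank z + 1 < block_rank (c 0)" for z
  proof (cases z)
    \<comment> \<open>The second hypothesis on \<open>z\<close> is used here. If
      \<open>A \<union> B\<close> were the only block, the sets \<open>F\<close> and
      \<open>N - F - (A \<union> B)\<close> would be empty, and the state of \<open>c 0\<close>
      would miss the least element although \<open>?s1\<close> contains it.\<close>
    case None
    have "\<not> w \<sqsubset>\<^bsub>block_poset N\<^esub> None" for w
      by (cases w) (auto simp: block_less block_le)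
    then have "1 < card (merge \<pi> A B)" using z(2) by (auto simp: None)
    then have "merge \<pi> A B \<noteq> {A \<union> B}" by auto
    then obtain D where D: "D \<in> merge \<pi> A B" "D \<noteq> A \<union> B" by (auto simp: merge_def)
    obtain d where d: "d \<in> D" using partition_on_elem[OF partition_merge D(1)] .
    have "d \<notin> A \<union> B"
      using partition_on_same_block[OF partition_merge D(1), of "A \<union> B" d] D(2) d by (auto simp: merge_def)
    moreover have "d \<in> N" using partition_merge D(1) d by (auto simp: partition_on_def)
    ultimately show ?thesis using B_E1 by (auto simp: None)
  next
    case (Some v)
    obtain \<tau> q where v: "v = (\<tau>, q)" by (cases v)
    have le: "Some (\<tau>, q) \<sqsubseteq>\<^bsub>block_poset N\<^esub> c 0" using z(1) by (simp only: Some v block_less)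
    obtain C w k M where C: "A \<subseteq> C" "B \<subseteq> C"
      and wk: "w + 0 \<le> q C" "q C < w + 0 + k"
      and out: "C = A \<union> B \<or> M \<or> C \<inter> (N - F - (A \<union> B)) \<noteq> {}"
      and k: "if C = A \<union> B then k = 1 else k \<ge> 2"
      and y: "\<forall>G0 G1. block_ideal y (F, A, G0, G1) (Some (\<tau>, q)) \<longleftrightarrow>
        M \<or> w < q C \<and> C \<inter> G1 \<noteq> {} \<or> q C < w + k \<and> C \<inter> G0 \<noteq> {}"
      and c: "\<forall>G0 G1. block_ideal (c 0) (F, A \<union> B, G0, G1) (Some (\<tau>, q)) \<longleftrightarrow>
        M \<or> w + 0 < q C \<and> C \<inter> G1 \<noteq> {} \<or> q C + 1 < w + 0 + k \<and> C \<inter> G0 \<noteq> {}"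
      by (rule below_c_cases[OF _ le]) simp
    have E1_C: "C \<inter> E1 \<noteq> {}" using B_E1 C by blast
    show ?thesis
    proof (cases "C = A \<union> B")
      case True
      then have "q C = w" using wk k by simp
      moreover have "C \<inter> (E0 - B) = {}" using True E by blast
      ultimately show ?thesis unfolding Some v y[rule_format] c[rule_format] by simp
    next
      case False
      have "w < q C \<or> q C + 1 < w + k" using wk k False by auto
      then show ?thesis unfolding Some v y[rule_format] c[rule_format] using E1_C out False wk by auto
    qed
  qed
  show ?thesis
    by (rule state_stepI, rule val, rule meas, rule val2)
      (use c_carrier c_less_y rank_c notin eq1 eq2 in simp_all)
qed

text \<open>Below \<open>c 1\<close> the inequality \<open>w < q C\<close> is automatic, so the old
  ideal depends on \<open>M\<close> and \<open>E1 - B\<close> only. When \<open>C\<close> contains a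
  further block, one of its inequalities relative to \<open>c 1\<close> is strict, and
  \<open>E1 - B\<close> serves for both choices.\<close>

lemma state_step_one:
  "state_step (block_poset N) block_rank (block_valid N) block_ideal (block_measure N)
    y (F, A, {}, E1)"
proof -
  let ?s1 = "(F, A, {}, E1 - B)" and ?s2 = "(F, A \<union> B, E1 - B, E1 - B)"
  have "card (E1 - B) < card E1"
    using B_E1 finite_E by (intro psubset_card_mono) auto
  then have meas: "block_measure N ?s1 < block_measure N (F, A, {}, E1)" by simp
  have val: "block_valid N y ?s1" using valid by auto
  have val2: "block_valid N (c 1) ?s2" using E by (intro valid_c) auto
  have notin: "\<not> block_ideal y ?s1 (c 1)" using E by (intro not_ideal_c) auto
  have eq1: "block_ideal y (F, A, {}, E1) z = (block_ideal y ?s1 z \<or> z \<sqsubseteq>\<^bsub>block_poset N\<^esub> c 1)"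
    if "z \<sqsubset>\<^bsub>block_poset N\<^esub> y" for z
  proof (cases z)
    case None
    then show ?thesis using B_E1 by (auto simp: block_le)
  next
    case (Some v)
    obtain \<tau> q where v: "v = (\<tau>, q)" by (cases v)
    have le: "Some (\<tau>, q) \<sqsubseteq>\<^bsub>block_poset N\<^esub> y" using that by (simp only: Some v block_less)
    obtain C w k M where wk: "w \<le> q C" "q C < w + k"
      and BC: "\<forall>x\<in>B. x \<in> C \<longleftrightarrow> B \<subseteq> C"
      and ideal: "\<forall>G0 G1. block_ideal y (F, A, G0, G1) (Some (\<tau>, q)) \<longleftrightarrow>
        M \<or> w < q C \<and> C \<inter> G1 \<noteq> {} \<or> q C + 1 < w + k \<and> C \<inter> G0 \<noteq> {}"
      and c: "\<forall>u\<le>1. Some (\<tau>, q) \<sqsubseteq>\<^bsub>block_poset N\<^esub> c u \<longleftrightarrow>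
        B \<subseteq> C \<and> w + u \<le> q C \<and> q C + 1 < w + u + k"
      by (rule below_y_cases[OF le])
    have "C \<inter> E1 \<noteq> {} \<longleftrightarrow> C \<inter> (E1 - B) \<noteq> {} \<or> B \<subseteq> C" using B_E1 BC by blast
    then show ?thesis unfolding Some v ideal[rule_format] using c[rule_format, of 1] wk by auto
  qed
  have eq2: "block_ideal y ?s1 z = block_ideal (c 1) ?s2 z" if z: "z \<sqsubset>\<^bsub>block_poset N\<^esub> c 1" for z
  proof (cases z)
    case (Some v)
    obtain \<tau> q where v: "v = (\<tau>, q)" by (cases v)
    have le: "Some (\<tau>, q) \<sqsubseteq>\<^bsub>block_poset N\<^esub> c 1" using z(1) by (simp only: Some v block_less)
    obtain C w k M where C: "A \<subseteq> C" "B \<subseteq> C"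
      and wk: "w + 1 \<le> q C" "q C < w + 1 + k"
      and out: "C = A \<union> B \<or> M \<or> C \<inter> (N - F - (A \<union> B)) \<noteq> {}"
      and k: "if C = A \<union> B then k = 1 else k \<ge> 2"
      and y: "\<forall>G0 G1. block_ideal y (F, A, G0, G1) (Some (\<tau>, q)) \<longleftrightarrow>
        M \<or> w < q C \<and> C \<inter> G1 \<noteq> {} \<or> q C < w + k \<and> C \<inter> G0 \<noteq> {}"
      and c: "\<forall>G0 G1. block_ideal (c 1) (F, A \<union> B, G0, G1) (Some (\<tau>, q)) \<longleftrightarrow>
        M \<or> w + 1 < q C \<and> C \<inter> G1 \<noteq> {} \<or> q C + 1 < w + 1 + k \<and> C \<inter> G0 \<noteq> {}"
      by (rule below_c_cases[OF _ le]) simp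
    show ?thesis
    proof (cases "C = A \<union> B")
      case True
      then have "C \<inter> (E1 - B) = {}" using E by blast
      then show ?thesis unfolding Some v y[rule_format] c[rule_format] by simp
    next
      case False
      have "w + 1 < q C \<or> q C + 1 < w + 1 + k" using wk k False by auto
      then show ?thesis unfolding Some v y[rule_format] c[rule_format] using wk by auto
    qed
  qed simp
  show ?thesis
    by (rule state_stepI, rule val, rule meas, rule val2)
      (use c_carrier c_less_y rank_c notin eq1 eq2 in simp_all)
qed

end

context
  fixes N :: "'a set"
  assumes N: "finite N" "N \<noteq> {}"
begin

text \<open>Once no merges of \<open>A\<close> are left, the state is replaced by the one in which a block \<open>D\<close> inside \<open>F\<close> takes the
  place of \<open>A\<close> and all its merges are listed explicitly.\<close>

lemma block_step_advance:
  assumes y: "(\<pi>, p) \<in> carrier (block_decorated_partitions N)"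
    and valid: "block_valid N (Some (\<pi>, p)) (F, A, {}, {})" and D: "D \<in> \<pi>" "D \<subseteq> F"
  shows "state_step (block_poset N) block_rank (block_valid N) block_ideal (block_measure N)
    (Some (\<pi>, p)) (F, A, {}, {})"
proof -
  \<comment> \<open>The listed merges join \<open>D\<close> with blocks outside \<open>F\<close>,
    with either choice; those with other blocks inside \<open>F\<close> are still covered by
    \<open>F - D\<close>.\<close>
  let ?y = "Some (\<pi>, p)" and ?s1 = "(F - D, D, N - F, N - F)"
  have part: "partition_on N \<pi>" using y by (simp add: block_decorated_carrier)
  have F: "F \<subseteq> N" "F \<inter> A = {}" "\<And>B. B \<in> \<pi> \<Longrightarrow> B \<subseteq> F \<or> F \<inter> B = {}" and A: "A \<in> \<pi>"
    using valid by auto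
  obtain d where d: "d \<in> D" using partition_on_elem[OF part D(1)] .
  have "B \<subseteq> F - D \<or> (F - D) \<inter> B = {}" if "B \<in> \<pi>" for B
    using F(3)[OF that] partition_on_same_block[OF part that D(1)] by blast
  then have val: "block_valid N ?y ?s1" using D F(1) by auto
  have finF: "finite F" using finite_subset[OF F(1)] N by simp
  have "card (F - D) < card F" using d D finF by (intro psubset_card_mono) auto
  then have "card (F - D) * (2 * card N + 1) + (2 * card N + 1) \<le> card F * (2 * card N + 1)"
    by (metis Suc_leI add.commute mult_Suc mult_le_mono1)
  moreover have "card (N - F) \<le> card N" using N by (intro card_mono) auto
  ultimately have meas: "block_measure N ?s1 < block_measure N (F, A, {}, {})" by simp
  have "block_ideal ?y (F, A, {}, {}) z = block_ideal ?y ?s1 z"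
    if z: "z \<sqsubset>\<^bsub>block_poset N\<^esub> ?y" for z
  proof (cases z)
    case None
    obtain a where "a \<in> A" using partition_on_elem[OF part A] .
    then have "a \<in> N - F" using F(2) A part by (auto simp: partition_on_def)
    moreover have "F \<noteq> {}" using d D by blast
    ultimately show ?thesis by (auto simp: None)
  next
    case (Some v)
    obtain \<tau> q where v: "v = (\<tau>, q)" by (cases v)
    have le: "(\<tau>, q) \<sqsubseteq>\<^bsub>block_decorated_partitions N\<^esub> (\<pi>, p)"
      using z by (simp add: Some v block_less block_le)
    then have r: "refines N \<pi> \<tau>" by (simp add: block_decorated_le_iff)
    obtain C where C: "C \<in> \<tau>" "D \<subseteq> C" using r D by (auto simp: refines_def)
    have C_N: "C \<subseteq> N" using C(1) r by (auto simp: refines_def partition_on_def)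
    let ?M = "\<lambda>F. \<exists>C\<in>\<tau>. C \<notin> \<pi> \<and> C \<inter> F \<noteq> {}"
    have bounds: "weight \<pi> p C \<le> q C" "q C < weight \<pi> p C + card (blocks_in \<pi> C)"
      using le C(1) by (auto simp: block_decorated_le_iff)
    have "?M F \<longleftrightarrow> ?M (F - D) \<or> weight \<pi> p C < q C \<and> C \<inter> (N - F) \<noteq> {} \<or>
        q C + 1 < weight \<pi> p C + card (blocks_in \<pi> C) \<and> C \<inter> (N - F) \<noteq> {}"
      (is "_ \<longleftrightarrow> ?r")
    proof
      assume "?M F"
      then obtain C' where C': "C' \<in> \<tau>" "C' \<notin> \<pi>" "C' \<inter> F \<noteq> {}" by blast
      show ?r
      proof (cases "?M (F - D)")
        \<comment> \<open>A new block that meets \<open>F\<close> only in \<open>D\<close> must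
          reach outside \<open>F\<close>; having at least two parts, it leaves room for one of the
          choices.\<close>
        case False
        then have "C' \<inter> (F - D) = {}" using C' by blast
        then obtain x where x: "x \<in> C'" "x \<in> D" using C'(3) by blast
        have "C' = C"
          using partition_on_same_block[of N \<tau> C' C x] r x C C'(1) by (auto simp: refines_def)
        with C' have "C \<noteq> D" "C \<notin> \<pi>" using D by auto
        then have "C \<inter> (N - F) \<noteq> {}"
          using \<open>C' \<inter> (F - D) = {}\<close> \<open>C' = C\<close> C_N C(2) by blast
        moreover have "1 < card (blocks_in \<pi> C)"
          using card_blocks_in_gt_one[OF N(1) r C(1) \<open>C \<notin> \<pi>\<close>] .
        then have "weight \<pi> p C < q C \<or> q C + 1 < weight \<pi> p C + card (blocks_in \<pi> C)"
          using bounds by linarith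
        ultimately show ?thesis by blast
      qed blast
    next
      assume ?r
      moreover have "?M F" if "C \<inter> (N - F) \<noteq> {}"
      proof -
        have "C \<noteq> D" using that D by blast
        then have "C \<notin> \<pi>" using partition_on_same_block[OF part _ D(1) _ d] C(2) d by blast
        moreover have "C \<inter> F \<noteq> {}" using d D C by blast
        ultimately show ?thesis using C(1) by blast
      qed
      ultimately show "?M F" by blast
    qed
    then show ?thesis
      unfolding Some v block_ideal_at[OF r D(1) C] by simp
  qed
  with val meas show ?thesis unfolding state_step_def by blast
qed

lemma block_ideal_states:
  "ideal_states (block_poset N) block_rank (block_valid N) block_ideal (block_measure N)"
proof -
  interpret partial_order "block_poset N"
    by (intro partial_order_adjoin_least partial_order_block_decorated N)
  show ?thesis
  proof unfold_locales
    fix y and s :: "'a set \<times> 'a set \<times> 'a set \<times> 'a set"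
    assume y: "y \<in> carrier (block_poset N)" and valid: "block_valid N y s"
    obtain F A E0 E1 where s: "s = (F, A, E0, E1)" by (cases s)
    show "(\<forall>z\<in>carrier (block_poset N). z \<sqsubset>\<^bsub>block_poset N\<^esub> y \<longrightarrow> \<not> block_ideal y s z) \<or>
      state_step (block_poset N) block_rank (block_valid N) block_ideal (block_measure N) y s"
    proof (cases y)
      case (Some v)
      obtain \<pi> p where v: "v = (\<pi>, p)" by (cases v)
      have y': "(\<pi>, p) \<in> carrier (block_decorated_partitions N)"
        using y by (simp add: Some v block_carrier)
      then have part: "partition_on N \<pi>" by (simp add: block_decorated_carrier)
      have val: "block_valid N (Some (\<pi>, p)) (F, A, E0, E1)" using valid by (simp only: Some v s)
      then have F: "F \<subseteq> N" "\<And>B. B \<in> \<pi> \<Longrightarrow> B \<subseteq> F \<or> F \<inter> B = {}" and A: "A \<in> \<pi>"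
        and E: "E0 \<subseteq> E1" "E1 \<subseteq> N - F - A" by auto
      have step: "\<exists>B. b \<in> B \<and> block_step N \<pi> A B p F E0 E1" if b: "b \<in> E1" for b
      proof -
        have "b \<in> N" using b E by blast
        then obtain B where B: "B \<in> \<pi>" "b \<in> B" by (rule partition_on_block[OF part])
        then have "A \<noteq> B" using b E by blast
        then have "block_step N \<pi> A B p F E0 E1"
          using N(1) part A B b y' val by unfold_locales auto
        with B show ?thesis by blast
      qed
      consider b where "b \<in> E0" | b where "b \<in> E1" "E0 = {}"
        | x where "E0 = {}" "E1 = {}" "x \<in> F" | "E0 = {}" "E1 = {}" "F = {}" by blast
      then show ?thesis
      proof cases
        case (1 b)
        then obtain B where B: "b \<in> B" and "block_step N \<pi> A B p F E0 E1" using step E by blast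
        from block_step.state_step_zero[OF this(2)] B 1 show ?thesis
          unfolding Some v s by blast
      next
        case (2 b)
        then obtain B where B: "b \<in> B" and "block_step N \<pi> A B p F E0 E1" using step by blast
        from block_step.state_step_one[OF this(2)] show ?thesis
          unfolding Some v s 2(2) by blast
      next
        case (3 x)
        have "x \<in> N" using 3 F by blast
        then obtain D where D: "D \<in> \<pi>" "x \<in> D" by (rule partition_on_block[OF part])
        then have "D \<subseteq> F" using F(2)[OF D(1)] 3 by blast
        from block_step_advance[OF y' _ D(1) this] val show ?thesis
          unfolding Some v s 3(1,2) by blast
      next
        case 4
        have "\<not> block_ideal y s z" for z by (cases z) (auto simp: Some v s 4)
        then show ?thesis by blast
      qed
    qed (simp add: block_ideal.simps(1))
  qed
qed

lemma block_interval_acyclic: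
  assumes x: "x \<in> carrier (block_poset N)" and y: "y \<in> carrier (block_poset N)"
    and xy: "x \<sqsubset>\<^bsub>block_poset N\<^esub> y"
  shows "acyclic_below K (block_poset N) (open_interval (block_poset N) x y)
    (int (block_rank y) - int (block_rank x) - 2)"
proof -
  interpret ideal_states "block_poset N" block_rank "block_valid N" block_ideal "block_measure N"
    by (rule block_ideal_states)
  obtain \<pi> p where v: "y = Some (\<pi>, p)"
    using xy by (cases x; cases y) (auto simp: block_less block_le)
  have part: "partition_on N \<pi>"
    using y by (simp add: v block_carrier block_decorated_carrier)
  have "\<pi> \<noteq> {}" using part N by (auto simp: partition_on_def)
  then obtain A where A: "A \<in> \<pi>" by blast
  show ?thesis
  \<comment> \<open>With a single block the state used below would have \<open>F\<close> empty and
    describe the empty ideal, but then the bound is at most -1.\<close>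
  proof (cases "\<pi> = {A}")
    case True
    then show ?thesis by (intro acyclic_below_minus_one) (simp add: v)
  next
    case False
    then obtain B where B: "B \<in> \<pi>" "B \<noteq> A" using A by blast
    show ?thesis
    proof (rule acyclic_below_open_interval[OF x y xy])
      \<comment> \<open>Every merge involves a block other than \<open>A\<close>, so
        \<open>F = N - A\<close> without listed merges describes everything below
        \<open>y\<close>.\<close>
      have "C \<subseteq> N - A \<or> (N - A) \<inter> C = {}" if "C \<in> \<pi>" for C
        using partition_on_same_block[OF part that A] that part by (auto simp: partition_on_def)
      then show "block_valid N y (N - A, A, {}, {})" using A by (auto simp: v)
      show "block_ideal y (N - A, A, {}, {}) z"
        if z: "z \<in> carrier (block_poset N)" "z \<sqsubset>\<^bsub>block_poset N\<^esub> y" for z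
      proof (cases z)
        case None
        obtain b where b: "b \<in> B" using partition_on_elem[OF part B(1)] .
        then have "b \<in> N - A"
          using partition_on_same_block[OF part B(1) A] B part by (auto simp: partition_on_def)
        then show ?thesis by (auto simp: None v)
      next
        case (Some w)
        obtain \<tau> q where w: "w = (\<tau>, q)" by (cases w)
        have r: "refines N \<pi> \<tau>" "\<tau> \<noteq> \<pi>"
          using block_less_card[OF N(1)] z y unfolding Some v w by blast+
        obtain C where C: "C \<in> \<tau>" "C \<notin> \<pi>" using refines_eqI[OF r(1)] r(2) by blast
        have "C \<inter> (N - A) \<noteq> {}"
        proof
          assume "C \<inter> (N - A) = {}"
          moreover have "C \<subseteq> N" using C(1) r(1) by (auto simp: refines_def partition_on_def)
          ultimately have "C \<subseteq> A" by blast
          moreover obtain x where "x \<in> C"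
            using partition_on_elem[OF _ C(1)] r(1) by (auto simp: refines_def)
          ultimately have "A \<subseteq> C" using refines_block_subset[OF r(1) A C(1)] by blast
          with \<open>C \<subseteq> A\<close> have "C = A" by simp
          with A C(2) show False by simp
        qed
        with C show ?thesis by (auto simp: Some v w)
      qed
    qed
  qed
qed

lemma cohen_macaulay_block_decorated: "cohen_macaulay TYPE('k::field) (block_poset N)"
proof (rule cohen_macaulayI)
  show "partial_order (block_poset N)"
    by (intro partial_order_adjoin_least partial_order_block_decorated N)
  have "carrier (block_decorated_partitions N) = Sigma {\<pi>. partition_on N \<pi>} (\<lambda>\<pi>. PiE \<pi> Com2)"
    by (auto simp: block_decorated_partitions_def)
  moreover have "finite (PiE \<pi> Com2 :: ('a set \<Rightarrow> nat) set)" if "partition_on N \<pi>" for \<pi>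
    using finite_elements[OF N(1) that] by (intro finite_PiE) (auto simp: Com2_def)
  ultimately have "finite (carrier (block_decorated_partitions N))"
    using finitely_many_partition_on[OF N(1)] by (auto intro: finite_SigmaI)
  then show "finite (carrier (block_poset N))"
    by (simp add: adjoin_least_simps(1))
  show "least (block_poset N) None (carrier (block_poset N))"
    by (simp add: least_def block_le block_carrier)
  \<comment> \<open>A singleton admits only the decoration 0, and over singletons a block
    \<open>A\<close> may take any value less than \<open>card A\<close>.\<close>
  let ?t = "(singletons N, \<lambda>B\<in>singletons N. 0)"
  have top: "?t \<in> carrier (block_decorated_partitions N)"
    using partition_on_singletons'[of N] by (auto simp: block_decorated_carrier singletons_def)
  have "(\<sigma>, q) \<sqsubseteq>\<^bsub>block_decorated_partitions N\<^esub> ?t"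
    if "(\<sigma>, q) \<in> carrier (block_decorated_partitions N)" for \<sigma> q
  proof -
    have \<sigma>: "partition_on N \<sigma>" "\<And>A. A \<in> \<sigma> \<Longrightarrow> q A < card A"
      using that by (auto simp: block_decorated_carrier)
    have "weight (singletons N) (\<lambda>B\<in>singletons N. 0) A = 0" for A
      by (simp add: weight_def blocks_in_def)
    moreover have "card (blocks_in (singletons N) A) = card A" if "A \<in> \<sigma>" for A
    proof -
      have "A \<subseteq> N" using that \<sigma>(1) by (auto simp: partition_on_def)
      then have "blocks_in (singletons N) A = singletons A" by (auto simp: blocks_in_def singletons_def)
      then show ?thesis by (simp add: card_singletons)
    qed
    ultimately show ?thesis
      using singletons_refines[OF \<sigma>(1)] \<sigma>(2) by (simp add: block_decorated_le_iff)
  qed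
  then have "x \<sqsubseteq>\<^bsub>block_poset N\<^esub> Some ?t" if "x \<in> carrier (block_poset N)" for x
    using that by (cases x) (auto simp: block_le block_carrier)
  then show "greatest (block_poset N) (Some ?t) (carrier (block_poset N))"
    using top by (simp add: greatest_def block_carrier)
  show "block_rank None = 0" by simp
next
  fix x y assume xy: "x \<in> carrier (block_poset N)" "y \<in> carrier (block_poset N)" "x \<sqsubset>\<^bsub>block_poset N\<^esub> y"
  then obtain \<pi> p where y: "y = Some (\<pi>, p)"
    by (cases x; cases y) (auto simp: block_less block_le)
  have y': "(\<pi>, p) \<in> carrier (block_decorated_partitions N)" using xy by (simp add: y block_carrier)
  then have part: "partition_on N \<pi>" by (simp add: block_decorated_carrier)
  note pos = card_partition_pos[OF N part]
  show "block_rank x < block_rank y"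
  proof (cases x)
    case (Some u)
    then show ?thesis
      using block_less_card(3)[OF N(1), of "fst u" "snd u" \<pi> p] xy by (cases u) (simp add: y)
  qed (use pos in \<open>simp add: y\<close>)
  show "\<exists>c\<in>carrier (block_poset N). x \<sqsubseteq>\<^bsub>block_poset N\<^esub> c \<and> c \<sqsubset>\<^bsub>block_poset N\<^esub> y \<and>
      block_rank y = block_rank c + 1"
  proof (cases "card \<pi> = 1")
    case True
    then have "x = None"
    proof (cases x)
      case (Some u)
      obtain \<sigma> q where u: "u = (\<sigma>, q)" by (cases u)
      have "card \<sigma> < card \<pi>" using block_less_card(3)[OF N(1)] xy unfolding Some u y by blast
      moreover have "0 < card \<sigma>"
        using xy(1) card_partition_pos[OF N, of \<sigma>] by (simp add: Some u block_carrier block_decorated_carrier)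
      ultimately show ?thesis using True by simp
    qed
    then show ?thesis using True by (intro bexI[of _ None]) (auto simp: y block_le block_less block_carrier)
  next
    case False
    have "\<exists>A B u. merge_blocks N \<pi> A B \<and> u \<le> 1 \<and>
      x \<sqsubseteq>\<^bsub>block_poset N\<^esub> Some (merge \<pi> A B, merge_decoration \<pi> p A B u)"
    proof (cases x)
      case None
      obtain A where "A \<in> \<pi>" using pos by fastforce
      moreover have "\<pi> \<noteq> {A}" using False by auto
      ultimately obtain B where "B \<in> \<pi>" "A \<noteq> B" by blast
      then have "merge_blocks N \<pi> A B" using N(1) part \<open>A \<in> \<pi>\<close> by unfold_locales
      then show ?thesis by (intro exI[of _ A] exI[of _ B] exI[of _ 0]) (simp add: None block_le)
    next
      case (Some v)
      obtain \<sigma> q where v: "v = (\<sigma>, q)" by (cases v)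
      have r: "refines N \<pi> \<sigma>" "\<sigma> \<noteq> \<pi>" using block_less_card[OF N(1)] xy unfolding Some v y by blast+
      have le: "(\<sigma>, q) \<sqsubseteq>\<^bsub>block_decorated_partitions N\<^esub> (\<pi>, p)"
        using xy(3) by (simp add: Some v y block_less block_le)
      obtain A B C where m: "merge_blocks N \<pi> A B" and C: "C \<in> \<sigma>" "A \<subseteq> C" "B \<subseteq> C"
        using coarser_merge[OF N(1) r] .
      interpret merge_blocks N \<pi> A B by fact
      have "refines N (merge \<pi> A B) \<sigma>" using merge_refines_iff r(1) C by blast
      from card_blocks_in_pos[OF N this C(1)] have k: "1 < card (blocks_in \<pi> C)"
        using card_blocks_in_merge[OF C(2,3)] by simp
      have bounds: "weight \<pi> p C \<le> q C" "q C < weight \<pi> p C + card (blocks_in \<pi> C)"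
        using le C(1) by (auto simp: block_decorated_le_iff)
      \<comment> \<open>Choice 1 if the lower bound is strict; otherwise \<open>q C\<close> is
        minimal and the upper bound is strict, since \<open>C\<close> contains two blocks of
        \<open>\<pi>\<close>.\<close>
      define u :: nat where "u = (if weight \<pi> p C < q C then 1 else 0)"
      have "weight \<pi> p C + u \<le> q C" "q C + 1 < weight \<pi> p C + u + card (blocks_in \<pi> C)"
        using bounds k by (auto simp: u_def)
      then have "(\<sigma>, q) \<sqsubseteq>\<^bsub>block_decorated_partitions N\<^esub> (merge \<pi> A B, merge_decoration \<pi> p A B u)"
        using merge_le_iff[of u \<sigma> q p] le C by (auto simp: u_def)
      then show ?thesis
        using m by (intro exI[of _ A] exI[of _ B] exI[of _ u]) (simp add: Some v block_le u_def)
    qed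
    then obtain A B u where m: "merge_blocks N \<pi> A B" and u: "u \<le> 1"
      and le: "x \<sqsubseteq>\<^bsub>block_poset N\<^esub> Some (merge \<pi> A B, merge_decoration \<pi> p A B u)" by blast
    interpret merge_blocks N \<pi> A B by fact
    let ?c = "(merge \<pi> A B, merge_decoration \<pi> p A B u)"
    interpret D: partial_order "block_decorated_partitions N"
      by (rule partial_order_block_decorated) (rule N)
    have c: "?c \<in> carrier (block_decorated_partitions N)" by (rule merge_decoration_carrier[OF y' u])
    then have "?c \<sqsubseteq>\<^bsub>block_decorated_partitions N\<^esub> (\<pi>, p)"
      using merge_le_iff[OF u] D.le_refl by blast
    moreover have "merge \<pi> A B \<noteq> \<pi>" using card_merge by auto
    ultimately have "Some ?c \<sqsubset>\<^bsub>block_poset N\<^esub> y" by (simp add: y block_less block_le)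
    moreover have "block_rank y = block_rank (Some ?c) + 1" using card_merge by (simp add: y)
    ultimately show ?thesis
      using c le by (intro bexI[of _ "Some ?c"]) (simp_all add: block_carrier)
  qed
  show "acyclic_below TYPE('k) (block_poset N) (open_interval (block_poset N) x y)
      (int (block_rank y) - int (block_rank x) - 2)"
    using xy by (rule block_interval_acyclic)
qed

end

theorem theorem4p4:
  fixes N :: "'a set"
  assumes "finite N" and "N \<noteq> {}"
  shows "cohen_macaulay TYPE('k::field_char_0) (adjoin_greatest (set_decorated_partitions N)) \<and>
         cohen_macaulay TYPE('k) (adjoin_least (block_decorated_partitions N))"
  using cohen_macaulay_set_decorated[OF assms] cohen_macaulay_block_decorated[OF assms] by blast

end
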